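(* Let $G$ be a finite Abelian group and let $A\subset G$ be a spectral set in $G$ with $|A|\le 5$. Then $A$ tiles $G$ by translation.
   Context: For a finite Abelian group $G$, a set $A\subseteq G$ is called spectral if there exists a set $\Lambda$ of characters of $G$ which forms an orthogonal basis of the space $L^2(A)$ of complex functions on $A$ (with counting measure, i.e. $\sum_{a\in A}\lambda(a)\overline{\lambda'(a)}=0$ for distinct $\lambda,\lambda'\in\Lambda$, and $|\Lambda|=|A|$); such $\Lambda$ is called a spectrum of $A$. The set $A$ tiles $G$ by translation if there exists $T\subseteq G$ such that $\sum_{t\in T}\chi_A(x-t)=1$ for all $x\in G$, i.e. every element of $G$ is uniquely of the form $a+t$ with $a\in A$, $t\in T$. *)

theory Defs
  imports Complex_Main
begin

definition character :: "('a::ab_group_add \<Rightarrow> complex) \<Rightarrow> bool" where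
  "character \<chi> \<longleftrightarrow> (\<forall>x. norm (\<chi> x) = 1) \<and> (\<forall>x y. \<chi> (x + y) = \<chi> x * \<chi> y)"

definition spectral :: "'a::{finite,ab_group_add} set \<Rightarrow> bool" where
  "spectral A \<longleftrightarrow> (\<exists>L. (\<forall>l\<in>L. character l) \<and> finite L \<and> card L = card A \<and>
     (\<forall>l\<in>L. \<forall>m\<in>L. l \<noteq> m \<longrightarrow> (\<Sum>a\<in>A. l a * cnj (m a)) = 0))"

definition tiles :: "'a::{finite,ab_group_add} set \<Rightarrow> bool" where
  "tiles A \<longleftrightarrow> (\<exists>T. \<forall>x. \<exists>!p. fst p \<in> A \<and> snd p \<in> T \<and> x = fst p + snd p)"

end

theory Submission
  imports Defs "HOL-Computational_Algebra.Polynomial_Factorial" "HOL-Number_Theory.Cong"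
begin

text \<open>Dividing a spectrum by one of its members gives \<open>card A - 1\<close> pairwise orthogonal characters
  (the rows) with sum 0 over \<open>A\<close>. If \<open>card A = p\<close> is prime and some row maps \<open>A\<close> bijectively onto a
  coset of the \<open>p\<close>-th roots of unity, then \<open>A\<close> tiles. For \<open>p = 2, 3\<close> this is immediate. For
  \<open>card A = 4\<close> there are a row \<open>l = (1, 1, -1, -1)\<close> up to a scalar and a row \<open>m\<close> with
  \<open>m = (1, -1, c, -c)\<close>, and a tiling complement is cut out by half systems for \<open>l\<close> and \<open>m\<close>.
  For \<open>card A = 5\<close> the entries are roots of unity, and a vanishing sum of five roots of unity is either a
  regular pentagon or contains an opposite pair, by Galois conjugation.
  If no row is a pentagon, then one row is \<open>(1, -1, b, b w, b w^2)\<close> up to a scalar, where \<open>w\<close> is a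
  primitive cube root of unity; this leaves so few possibilities for the other three rows that two of
  them fail to be orthogonal.\<close>

section \<open>Galois conjugation of vanishing sums of roots of unity\<close>

text \<open>The inner binomial coefficients of a prime are divisible by it. The ring is left general
  because both integers and integer polynomials are treated this way.\<close>

lemma prime_dvd_power_add:
  fixes u v :: "'a::comm_ring_1"
  assumes "prime (q::nat)"
  shows "of_nat q dvd (u + v) ^ q - u ^ q - v ^ q"
proof -
  have q: "q > 0" using assms prime_gt_0_nat by blast
  have "(u + v) ^ q = (\<Sum>k\<le>q. of_nat (q choose k) * u ^ k * v ^ (q - k))"
    by (simp add: binomial_ring)
  also have "{..q} = insert 0 (insert q {0<..<q})" using q by auto
  also have "(\<Sum>k\<in>insert 0 (insert q {0<..<q}). of_nat (q choose k) * u ^ k * v ^ (q - k))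
     = v ^ q + (u ^ q + (\<Sum>k\<in>{0<..<q}. of_nat (q choose k) * u ^ k * v ^ (q - k)))"
    using q by simp
  finally have eq: "(u + v) ^ q - u ^ q - v ^ q
     = (\<Sum>k\<in>{0<..<q}. of_nat (q choose k) * u ^ k * v ^ (q - k))" by simp
  have "of_nat q dvd (of_nat (q choose k) * u ^ k * v ^ (q - k) :: 'a)" if "k \<in> {0<..<q}" for k
  proof -
    have "q dvd (q choose k)" using that assms by (intro dvd_choose_prime) auto
    then obtain c where "q choose k = q * c" by (auto elim: dvdE)
    then show ?thesis by (simp add: mult.assoc)
  qed
  then show ?thesis unfolding eq by (intro dvd_sum) auto
qed

lemma fermat_int:
  assumes "prime (q::nat)"
  shows "int q dvd a ^ q - a"
proof -
  \<comment> \<open>An equivalence rather than an implication, so that the induction can run both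
    upwards and downwards from 0.\<close>
  have step: "int q dvd (i + 1) ^ q - (i + 1) \<longleftrightarrow> int q dvd i ^ q - i" for i :: int
  proof -
    have "int q dvd (i + 1) ^ q - i ^ q - 1"
      using prime_dvd_power_add[OF assms, of i 1] by simp
    then have "int q dvd ((i + 1) ^ q - i ^ q - 1) + (i ^ q - i) \<longleftrightarrow> int q dvd i ^ q - i"
      by (rule dvd_add_right_iff)
    moreover have "((i + 1) ^ q - i ^ q - 1) + (i ^ q - i) = (i + 1) ^ q - (i + 1)" by simp
    ultimately show ?thesis by metis
  qed
  show ?thesis
  proof (induction a rule: int_induct[where k = 0])
    case base
    then show ?case using assms prime_gt_0_nat[of q] by (simp add: power_0_left)
  next
    case (step1 i)
    then show ?case using step by blast
  next
    case (step2 i)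
    then show ?case using step[of "i - 1"] by simp
  qed
qed

section \<open>Values of integer polynomials at complex numbers, and minimal polynomials\<close>

definition int_eval :: "int poly \<Rightarrow> complex \<Rightarrow> complex" where
  "int_eval p z = poly (map_poly of_int p) z"

lemma int_eval_0 [simp]: "int_eval 0 z = 0"
  and int_eval_pCons [simp]: "int_eval (pCons c p) z = of_int c + z * int_eval p z"
  by (simp_all add: int_eval_def map_poly_pCons)

lemma int_eval_1 [simp]: "int_eval 1 z = 1"
  by (simp add: one_pCons)

lemma int_eval_add [simp]: "int_eval (p + q) z = int_eval p z + int_eval q z"
  by (induction p q rule: poly_induct2) (simp_all add: algebra_simps)

lemma int_eval_smult [simp]: "int_eval (smult c p) z = of_int c * int_eval p z"
  by (induction p) (simp_all add: algebra_simps)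

lemma int_eval_uminus [simp]: "int_eval (- p) z = - int_eval p z"
  using int_eval_smult[of "-1" p z] by simp

lemma int_eval_diff [simp]: "int_eval (p - q) z = int_eval p z - int_eval q z"
  using int_eval_add[of p "- q" z] by simp

lemma int_eval_mult [simp]: "int_eval (p * q) z = int_eval p z * int_eval q z"
  by (induction p) (simp_all add: algebra_simps)

lemma int_eval_power [simp]: "int_eval (p ^ n) z = int_eval p z ^ n"
  by (induction n) simp_all

lemma int_eval_monom [simp]: "int_eval (monom c n) z = of_int c * z ^ n"
  by (simp add: int_eval_def map_poly_monom poly_monom)

lemma int_eval_sum [simp]: "int_eval (sum f S) z = (\<Sum>i\<in>S. int_eval (f i) z)"
  by (induction S rule: infinite_finite_induct) simp_all

lemma int_eval_pcompose [simp]: "int_eval (pcompose p r) z = int_eval p (int_eval r z)"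
  by (induction p) (simp_all add: pcompose_pCons)

text \<open>Frobenius modulo \<open>q\<close>: the \<open>q\<close>-th power is additive modulo
  \<open>q\<close>, and by Fermat's little theorem it fixes the coefficients.\<close>

lemma pcompose_prime_power:
  assumes "prime (q::nat)"
  shows "of_nat q dvd pcompose p (monom 1 q) - (p :: int poly) ^ q"
proof (induction p)
  case 0
  then show ?case using assms prime_gt_0_nat[of q] by (simp add: power_0_left)
next
  case (pCons a p)
  let ?Q = "of_nat q :: int poly" and ?X = "monom 1 1 :: int poly"
  have pc: "pCons a p = [:a:] + ?X * p"
    by (simp add: monom_altdef)
  have 1: "?Q dvd ([:a:] + ?X * p) ^ q - [:a:] ^ q - (?X * p) ^ q"
    by (rule prime_dvd_power_add[OF assms])
  obtain c where "a ^ q - a = int q * c" using fermat_int[OF assms] by (auto elim: dvdE)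
  then have "[:a:] ^ q - [:a:] = ?Q * [:c:]"
    by (simp add: of_nat_poly poly_const_pow)
  then have 2: "?Q dvd [:a:] ^ q - [:a:]" by (metis dvd_triv_left)
  have 3: "?Q dvd monom 1 q * (pcompose p (monom 1 q) - p ^ q)"
    by (rule dvd_mult) (rule pCons.IH)
  have "(?X * p) ^ q = monom 1 q * p ^ q"
    by (simp add: power_mult_distrib monom_power)
  then have "pcompose (pCons a p) (monom 1 q) - (pCons a p) ^ q
     = monom 1 q * (pcompose p (monom 1 q) - p ^ q) - ([:a:] ^ q - [:a:])
       - (([:a:] + ?X * p) ^ q - [:a:] ^ q - (?X * p) ^ q)"
    unfolding pcompose_pCons pc[symmetric] by (simp only: right_diff_distrib)
  then show ?case using 1 2 3 by (metis dvd_diff)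
qed

lemma int_eval_prime_factor:
  assumes "int_eval p z = 0" "p \<noteq> 0"
  shows "\<exists>m. prime_elem m \<and> m dvd p \<and> int_eval m z = 0"
  using assms
proof (induction p rule: prime_divisors_induct)
  case (unit p)
  then obtain r where "p * r = 1" by (auto elim: dvdE)
  then have "int_eval p z * int_eval r z = 1" by (metis int_eval_1 int_eval_mult)
  then have False using unit.prems(1) by simp
  then show ?case by blast
next
  case (factor p x)
  show ?case
  proof (cases "int_eval p z = 0")
    case True
    then show ?thesis using factor(1) by (auto intro!: exI[of _ p])
  next
    case False
    then have "int_eval x z = 0" "x \<noteq> 0" using factor.prems by auto
    then show ?thesis using factor(2) by (meson dvd_mult)
  qed
qed simp

text \<open>An annihilating polynomial of least degree has a prime factor \<open>m\<close> that
  still annihilates \<open>z\<close>. By pseudo-division \<open>m\<close> divides a nonzero integer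
  multiple of \<open>f\<close>, and primality lets that integer cancel, so rational coefficients are
  avoided.\<close>

lemma ex_minimal_int_poly:
  assumes "int_eval p z = 0" "p \<noteq> 0"
  obtains m where "prime_elem m" "degree m > 0" "int_eval m z = 0"
    "\<And>f. int_eval f z = 0 \<Longrightarrow> m dvd f"
proof -
  let ?P = "\<lambda>g. g \<noteq> 0 \<and> int_eval g z = 0"
  obtain g where g: "?P g" and min: "\<And>h. ?P h \<Longrightarrow> degree g \<le> degree h"
    using assms ex_has_least_nat[of ?P p degree] by blast
  obtain m where m: "prime_elem m" "m dvd g" "int_eval m z = 0"
    using int_eval_prime_factor g by blast
  have m0: "m \<noteq> 0" using m by auto
  have degm: "degree m = degree g"
    using min[of m] m m0 g dvd_imp_degree_le[of m g] by auto
  have pos: "degree m > 0"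
  proof (rule ccontr)
    assume "\<not> degree m > 0"
    then obtain c where "m = [:c:]" by (auto elim: degree_eq_zeroE)
    then show False using m m0 by simp
  qed
  have "m dvd f" if f: "int_eval f z = 0" for f
  proof -
    obtain a h where ah: "a \<noteq> 0" "smult a f = m * h + pseudo_mod f m"
      using pseudo_mod(1)[OF m0] by blast
    have "int_eval (pseudo_mod f m) z = 0"
      using arg_cong[OF ah(2), of "\<lambda>f. int_eval f z"] f m by simp
    then have "pseudo_mod f m = 0"
      using pseudo_mod(2)[OF m0, of f] min[of "pseudo_mod f m"] degm by force
    then have "m dvd [:a:] * f" using ah by simp
    moreover have "\<not> m dvd [:a:]"
      using pos ah(1) dvd_imp_degree_le[of m "[:a:]"] by auto
    ultimately show ?thesis using m(1) prime_elem_dvd_mult_iff by blast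
  qed
  then show ?thesis using that m pos by blast
qed

text \<open>As the leading coefficient of \<open>m\<close> is invertible, the quotient ring by
  \<open>m\<close> is free over the integers with 1 in a basis, so an integer divisible by
  \<open>q\<close> there is divisible by \<open>q\<close> already. The proof lowers the degree of
  \<open>w\<close>.\<close>

lemma monic_multiple_const_mod:
  fixes m :: "int poly"
  assumes "is_unit (lead_coeff m)" "degree m > 0"
    and "m * w + smult q k = [:n:]"
  shows "q dvd n"
  using assms(3)
proof (induction "degree w" arbitrary: w k rule: less_induct)
  case less
  show ?case
  proof (cases "w = 0")
    case True
    then have "coeff (smult q k) 0 = n" using less.prems by simp
    then show ?thesis by auto
  next
    case False
    have m0: "m \<noteq> 0" using assms by auto
    \<comment> \<open>The right-hand side is constant, so the top coefficient of
      \<open>m * w\<close> cancels against a multiple of \<open>q\<close>. Hence \<open>q\<close>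
      divides \<open>lead_coeff w\<close>, and the leading term of \<open>w\<close> can be moved
      into the \<open>q\<close> part.\<close>
    have "coeff (m * w) (degree m + degree w) = lead_coeff m * lead_coeff w"
      by (rule coeff_mult_degree_sum)
    moreover have "coeff (m * w + smult q k) (degree m + degree w) = 0"
      unfolding less.prems using assms(2) by (simp add: coeff_pCons split: nat.split)
    ultimately have "lead_coeff m * lead_coeff w = q * (- coeff k (degree m + degree w))"
      by simp
    then have "q dvd lead_coeff m * lead_coeff w" by (metis dvd_triv_left)
    then have "q dvd lead_coeff w" using assms(1) by (simp only: dvd_mult_unit_iff')
    then obtain c where c: "lead_coeff w = q * c" by (auto elim: dvdE)
    define v where "v = w - monom (lead_coeff w) (degree w)"
    have eq: "m * v + smult q (k + m * monom c (degree w)) = [:n:]"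
    proof -
      have "monom (lead_coeff w) (degree w) = smult q (monom c (degree w))"
        by (simp add: c smult_monom)
      then show ?thesis using less.prems by (simp add: v_def algebra_simps smult_add_right)
    qed
    show ?thesis
    proof (cases "degree w = 0")
      case True
      then have "v = 0" by (auto simp: v_def monom_0 elim: degree_eq_zeroE)
      then show ?thesis using eq by (metis Polynomial.coeff_pCons_0 coeff_smult dvd_triv_left add_0 mult_zero_right)
    next
      case False
      have "degree v < degree w"
      proof (rule degree_lessI)
        show "v \<noteq> 0 \<or> degree w > 0" using False by simp
        show "\<forall>i\<ge>degree w. coeff v i = 0"
          by (auto simp: v_def coeff_eq_0)
      qed
      then show ?thesis using less.hyps eq by blast
    qed
  qed
qed

text \<open>If the minimal polynomial \<open>m\<close> of \<open>z\<close>, with \<open>x^N - 1 = m h\<close>, did not vanish at \<open>z^q\<close>,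
  then evaluating the derivative of \<open>m h\<close> at \<open>z^q\<close> would write \<open>N\<close> as
  \<open>m(z^q)\<close> times an element of \<open>\<int>[z]\<close>; but \<open>m(z^q)\<close> is congruent to \<open>m(z)^q = 0\<close> modulo \<open>q\<close>.\<close>

lemma int_eval_root_of_unity_prime_power:
  assumes z: "z ^ N = 1" "N > 0" and q: "prime q" "\<not> q dvd N" and f: "int_eval f z = 0"
  shows "int_eval f (z ^ q) = 0"
proof (rule ccontr)
  assume nz: "int_eval f (z ^ q) \<noteq> 0"
  define F :: "int poly" where "F = monom 1 N - 1"
  have F0: "F \<noteq> 0"
  proof
    assume "F = 0"
    then have "coeff F 0 = 0" by simp
    then show False using z by (simp add: F_def)
  qed
  have Fz: "int_eval F z = 0" using z by (simp add: F_def)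
  obtain m where m: "prime_elem m" "degree m > 0" "int_eval m z = 0"
    and dvd: "\<And>f. int_eval f z = 0 \<Longrightarrow> m dvd f"
    using ex_minimal_int_poly[OF Fz F0] by blast
  have mq: "int_eval m (z ^ q) \<noteq> 0"
    using dvd[OF f] nz by (auto elim!: dvdE)
  obtain h where h: "F = m * h" using dvd[OF Fz] by (auto elim: dvdE)
  have lcF: "lead_coeff F = 1"
  proof -
    have "degree F = N"
      using z(2) degree_add_eq_left[of "- 1" "monom 1 N :: int poly"]
      by (simp add: F_def degree_monom_eq)
    then show ?thesis using z(2) by (simp add: F_def)
  qed
  have unit: "is_unit (lead_coeff m)"
    using lcF unfolding h lead_coeff_mult by (metis dvd_triv_left)
  have zqN: "(z ^ q) ^ N = 1" using z(1) by (metis power_mult mult.commute power_one)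
  then have "int_eval F (z ^ q) = 0" by (simp add: F_def)
  then have hq: "int_eval h (z ^ q) = 0" using mq by (simp add: h)
  have "pderiv F = monom (of_nat N) (N - 1)"
    by (simp add: F_def pderiv_diff pderiv_monom)
  then have "int_eval (pderiv F) (z ^ q) = of_nat N * (z ^ q) ^ (N - 1)" by simp
  moreover have "int_eval (pderiv F) (z ^ q) = int_eval m (z ^ q) * int_eval (pderiv h) (z ^ q)"
    by (simp add: h pderiv_mult hq)
  ultimately have 1: "of_nat N * (z ^ q) ^ (N - 1) = int_eval m (z ^ q) * int_eval (pderiv h) (z ^ q)"
    by simp
  obtain g where g: "pcompose m (monom 1 q) - m ^ q = of_nat q * g"
    using pcompose_prime_power[OF q(1)] by (auto elim: dvdE)
  have "int_eval (pcompose m (monom 1 q) - m ^ q) z = of_nat q * int_eval g z"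
    unfolding g by (simp add: of_nat_poly)
  then have 2: "int_eval m (z ^ q) = of_nat q * int_eval g z"
    using m(3) q(1) prime_gt_0_nat[of q] by (simp add: power_0_left)
  \<comment> \<open>Multiplying the derivative identity by \<open>z ^ q\<close> turns
    \<open>(z ^ q) ^ (N - 1)\<close> into 1, so \<open>k\<close> is an integer polynomial for which
    \<open>N\<close> is \<open>q\<close> times its value at \<open>z\<close>.\<close>
  define k where "k = g * pcompose (pderiv h) (monom 1 q) * monom 1 q"
  have "of_nat N = of_nat N * ((z ^ q) ^ (N - 1) * z ^ q)"
  proof -
    have "(z ^ q) ^ (N - 1) * z ^ q = (z ^ q) ^ N"
      using z(2) by (metis power_minus_mult)
    also have "\<dots> = 1" by (rule zqN)
    finally show ?thesis by simp
  qed
  also have "\<dots> = of_nat q * int_eval k z"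
    using 1 2 by (simp add: k_def mult_ac)
  finally have "int_eval ([:int N:] - smult (int q) k) z = 0" by simp
  then have "m dvd [:int N:] - smult (int q) k" by (rule dvd)
  then obtain w where "[:int N:] - smult (int q) k = m * w" by (rule dvdE)
  then have "m * w + smult (int q) k = [:int N:]" by (simp add: algebra_simps)
  then have "int q dvd int N" using monic_multiple_const_mod unit m(2) by blast
  then show False using q(2) by simp
qed

text \<open>The prime factors of \<open>j\<close> are applied one at a time; the base
  \<open>z\<close> must vary because each step passes from \<open>z\<close> to
  \<open>z ^ p\<close>.\<close>

lemma int_eval_root_of_unity_coprime_power:
  assumes "z ^ N = 1" "N > 0" "coprime j N" "int_eval f z = 0"
  shows "int_eval f (z ^ j) = 0"
  using assms
proof (induction j arbitrary: z rule: prime_divisors_induct)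
  case zero
  \<comment> \<open>Exponent 0 is coprime to \<open>N\<close> only for \<open>N = 1\<close>, where
    \<open>z = 1\<close>.\<close>
  then have "N = 1" by simp
  then show ?case using \<open>z ^ N = 1\<close> \<open>int_eval f z = 0\<close> by simp
next
  case (unit j)
  then have "j = 1" by simp
  then show ?case using \<open>int_eval f z = 0\<close> by simp
next
  case (factor p j)
  have "prime p" by (rule factor(1))
  have cop: "coprime p N" "coprime j N" using factor.prems by auto
  have "\<not> p dvd N" using cop(1) \<open>prime p\<close>
    using coprime_common_divisor[of p N p] not_prime_unit by auto
  then have "int_eval f (z ^ p) = 0"
    using int_eval_root_of_unity_prime_power factor.prems \<open>prime p\<close> by blast
  moreover have "(z ^ p) ^ N = 1"
    using factor.prems(1) by (metis power_mult mult.commute power_one)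
  ultimately have "int_eval f ((z ^ p) ^ j) = 0"
    using factor cop by blast
  then show ?case by (simp add: power_mult)
qed

text \<open>All terms are powers of one primitive \<open>N\<close>-th root of unity, so the sum is
  the value of an integer polynomial at it, and conjugation replaces that root by its
  \<open>j\<close>-th power.\<close>

lemma sum_roots_of_unity_coprime_power:
  fixes w :: "'b \<Rightarrow> complex"
  assumes "finite A" "N > 0" "\<And>a. a \<in> A \<Longrightarrow> w a ^ N = 1" "(\<Sum>a\<in>A. w a) = 0" "coprime j N"
  shows "(\<Sum>a\<in>A. w a ^ j) = 0"
proof -
  define z where "z = cis (2 * pi / real N)"
  have zN: "z ^ N = 1" using assms(2) by (simp add: z_def DeMoivre)
  have "\<exists>e. w a = z ^ e" if "a \<in> A" for a
  proof -
    have "w a \<in> (\<lambda>k. cis (2 * pi * real k / real N)) ` {..<N}"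
      using bij_betw_roots_unity[OF assms(2)] assms(3)[OF that] by (auto simp: bij_betw_def)
    then obtain k where "w a = cis (2 * pi * real k / real N)" by auto
    then have "w a = z ^ k" by (simp add: z_def DeMoivre mult_ac)
    then show ?thesis by blast
  qed
  then obtain e where e: "\<And>a. a \<in> A \<Longrightarrow> w a = z ^ e a" by metis
  have "int_eval (\<Sum>a\<in>A. monom 1 (e a)) z = 0"
    using assms(4) e by simp
  then have "int_eval (\<Sum>a\<in>A. monom 1 (e a)) (z ^ j) = 0"
    using int_eval_root_of_unity_coprime_power zN assms by blast
  moreover have "(z ^ j) ^ e a = w a ^ j" if "a \<in> A" for a
    using e[OF that] by (metis power_mult mult.commute)
  ultimately show ?thesis by simp
qed

section \<open>Vanishing sums of five roots of unity\<close>

lemma sum_powers_root_of_unity: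
  fixes x :: complex
  assumes "x ^ p = 1"
  shows "(\<Sum>t<p. x ^ t) = (if x = 1 then of_nat p else 0)"
  using assms by (auto simp: geometric_sum)

text \<open>The exponents \<open>1 + t M\<close> coprime to \<open>N = p M\<close> are those with \<open>p\<close> not dividing
  \<open>1 + t M\<close>: all of them if \<open>p\<close> divides \<open>M\<close>, and otherwise all but one residue \<open>t0\<close> modulo \<open>p\<close>.
  A finite Fourier transform in \<open>t\<close> separates the classes of \<open>A\<close> under \<open>w ^ M\<close>.\<close>

lemma root_of_unity_class_sums:
  fixes w :: "'b \<Rightarrow> complex"
  assumes fin: "finite A" and p: "prime p" and M: "M > 0"
    and w: "\<And>a. a \<in> A \<Longrightarrow> w a ^ (p * M) = 1" and s: "(\<Sum>a\<in>A. w a) = 0"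
  obtains t0 D where "\<not> p dvd t0"
    "\<And>u. u ^ p = 1 \<Longrightarrow> of_nat p * (\<Sum>a\<in>{a\<in>A. w a ^ M = u}. w a) * u ^ t0 = D"
    "p dvd M \<Longrightarrow> D = 0"
proof -
  define S where "S t = (\<Sum>a\<in>A. w a ^ (1 + t * M))" for t
  have p1: "p > 1" using p prime_gt_1_nat by blast
  have S0: "S t = 0" if "\<not> p dvd 1 + t * M" for t
  proof -
    have "coprime (1 + t * M) M"
    proof (rule coprimeI)
      fix d assume "d dvd 1 + t * M" "d dvd M"
      then show "is_unit d" using dvd_add_left_iff[of d "t * M" 1] by simp
    qed
    moreover have "coprime (1 + t * M) p"
      using prime_imp_coprime[OF p that] by (simp add: coprime_commute)
    ultimately have "coprime (1 + t * M) (p * M)" by simp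
    then show ?thesis
      unfolding S_def using sum_roots_of_unity_coprime_power[of A "p * M" w] fin w s M p1 by (simp del: power_Suc)
  qed
  \<comment> \<open>Fourier inversion over the \<open>p\<close>-th roots of unity: the geometric sum
    in \<open>t\<close> is \<open>p\<close> for the elements with \<open>w a ^ M = u\<close> and 0
    for the others.\<close>
  have four: "(\<Sum>t<p. inverse u ^ t * S t) = of_nat p * (\<Sum>a\<in>{a\<in>A. w a ^ M = u}. w a)"
    if u: "u ^ p = 1" for u
  proof -
    have u0: "u \<noteq> 0" using u p1 by (auto simp: power_0_left)
    have "(\<Sum>t<p. inverse u ^ t * S t) = (\<Sum>t<p. \<Sum>a\<in>A. w a * (inverse u * w a ^ M) ^ t)"
      unfolding S_def sum_distrib_left
      by (intro sum.cong refl) (simp add: power_mult_distrib power_add power_mult mult_ac flip: power_mult)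
    also have "\<dots> = (\<Sum>a\<in>A. w a * (\<Sum>t<p. (inverse u * w a ^ M) ^ t))"
      by (subst sum.swap) (simp add: sum_distrib_left)
    also have "\<dots> = (\<Sum>a\<in>A. w a * (if w a ^ M = u then of_nat p else 0))"
    proof (intro sum.cong refl)
      fix a assume a: "a \<in> A"
      have "(w a ^ M) ^ p = 1" using w[OF a] by (metis power_mult mult.commute)
      then have "(inverse u * w a ^ M) ^ p = 1"
        using u by (simp add: power_mult_distrib power_inverse)
      moreover have "inverse u * w a ^ M = 1 \<longleftrightarrow> w a ^ M = u"
        using u0 by (auto simp: field_simps)
      ultimately show "w a * (\<Sum>t<p. (inverse u * w a ^ M) ^ t) = w a * (if w a ^ M = u then of_nat p else 0)"
        by (simp add: sum_powers_root_of_unity)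
    qed
    also have "\<dots> = (\<Sum>a\<in>A. if w a ^ M = u then of_nat p * w a else 0)"
      by (intro sum.cong refl) simp
    also have "\<dots> = (\<Sum>a\<in>{a\<in>A. w a ^ M = u}. of_nat p * w a)"
      using fin by (simp add: sum.inter_filter)
    finally show ?thesis by (simp add: sum_distrib_left)
  qed
  show ?thesis
  proof (cases "p dvd M")
    case True
    have "\<not> p dvd 1 + t * M" for t
      using True p1 dvd_add_left_iff[of p "t * M" 1] by simp
    then have "S t = 0" for t using S0 by blast
    then have "of_nat p * (\<Sum>a\<in>{a\<in>A. w a ^ M = u}. w a) * u ^ 1 = 0" if "u ^ p = 1" for u
      using four[OF that] by simp
    \<comment> \<open>All \<open>S t\<close> vanish here, so any exponent prime to \<open>p\<close>
      serves; 1 is taken.\<close>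
    then show ?thesis using that[of 1 0] p1 by simp
  next
    case False
    then have cop: "coprime M p" using prime_imp_coprime[OF p] by (simp add: coprime_commute)
    then obtain x where x: "[M * x = 1] (mod p)" using cong_solve_coprime_nat[of M p] by auto
    \<comment> \<open>The natural number \<open>(p - 1) * x\<close> represents the negative of an
      inverse of \<open>M\<close> modulo \<open>p\<close>, so \<open>t0\<close> solves
      \<open>1 + t0 * M = 0\<close> modulo \<open>p\<close>.\<close>
    define t0 where "t0 = (p - 1) * x mod p"
    have t0p: "t0 < p" using p1 by (simp add: t0_def)
    have "[1 + t0 * M = 1 + (p - 1) * (M * x)] (mod p)"
    proof -
      have "[t0 * M = (p - 1) * x * M] (mod p)"
        unfolding t0_def by (intro cong_scalar_right) (simp add: cong_def)
      then show ?thesis by (intro cong_add) (simp_all add: mult_ac)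
    qed
    also have "[1 + (p - 1) * (M * x) = 1 + (p - 1) * 1] (mod p)"
      using x by (intro cong_add cong_mult) auto
    also have "1 + (p - 1) * 1 = p" using p1 by simp
    finally have t0: "p dvd 1 + t0 * M" by (simp add: cong_def mod_eq_0_iff_dvd)
    have uniq: "t = t0" if "t < p" "p dvd 1 + t * M" for t
    proof -
      have "[1 + t * M = 1 + t0 * M] (mod p)"
        using that t0 by (simp add: cong_def)
      then have "[t = t0] (mod p)"
        using cop by (metis cong_add_lcancel_nat cong_mult_rcancel_nat)
      then show ?thesis using that t0p by (simp add: cong_less_modulus_unique_nat)
    qed
    have "\<not> p dvd t0"
    proof
      assume "p dvd t0"
      then have "t0 = 0" using t0p by (auto dest: dvd_imp_le)
      then show False using t0 p1 by simp
    qed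
    moreover have "of_nat p * (\<Sum>a\<in>{a\<in>A. w a ^ M = u}. w a) * u ^ t0 = S t0" if u: "u ^ p = 1" for u
    proof -
      have u0: "u \<noteq> 0" using u p1 by (auto simp: power_0_left)
      have "(\<Sum>t<p. inverse u ^ t * S t) = (\<Sum>t\<in>{t0}. inverse u ^ t * S t)"
        by (rule sum.mono_neutral_right) (use t0p uniq S0 in auto)
      then have "of_nat p * (\<Sum>a\<in>{a\<in>A. w a ^ M = u}. w a) = inverse u ^ t0 * S t0"
        using four[OF u] by simp
      then show ?thesis using u0 by (simp add: power_inverse)
    qed
    ultimately show ?thesis using that[of t0 "S t0"] False by blast
  qed
qed

section \<open>Short sums of complex numbers of norm 1, and cube roots of unity\<close>

lemma cnj_norm_1: "norm (z::complex) = 1 \<Longrightarrow> cnj z = inverse z"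
  using complex_norm_square[of z] by (intro inverse_unique[symmetric]) simp

lemma norm_root_of_unity: "z ^ n = 1 \<Longrightarrow> n > 0 \<Longrightarrow> norm (z::complex) = 1"
  by (metis norm_one norm_power norm_ge_zero power_eq_1_iff neq0_conv)

text \<open>Conjugation inverts numbers of norm 1, so the norm condition becomes rational and clears
  to \<open>(x + y) * ((x + z) * (y + z)) = 0\<close>.\<close>

lemma three_units_sum_unit:
  fixes x y z :: complex
  assumes "norm x = 1" "norm y = 1" "norm z = 1" "norm (x + y + z) = 1"
  shows "x + y = 0 \<or> x + z = 0 \<or> y + z = 0"
proof -
  have nz: "x \<noteq> 0" "y \<noteq> 0" "z \<noteq> 0" using assms by auto
  have "(x + y + z) * cnj (x + y + z) = 1"
    using assms(4) by (simp only: complex_norm_square[symmetric]) simp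
  then have "(x + y + z) * (inverse x + inverse y + inverse z) = 1"
    using assms by (simp add: cnj_norm_1)
  then have "(x + y) * ((x + z) * (y + z)) = 0"
    using nz by (simp add: field_simps)
  then show ?thesis by simp
qed

lemma four_units_sum_0:
  fixes x y z w :: complex
  assumes "norm x = 1" "norm y = 1" "norm z = 1" "norm w = 1" "x + y + z + w = 0"
  shows "x + y = 0 \<or> x + z = 0 \<or> x + w = 0"
proof -
  have "x + y + z = - w" using assms(5) by (simp add: eq_neg_iff_add_eq_0)
  then have "norm (x + y + z) = 1" using assms(4) by simp
  then have "x + y = 0 \<or> x + z = 0 \<or> y + z = 0" using three_units_sum_unit assms by blast
  then show ?thesis using assms(5) by (auto simp: algebra_simps)
qed

lemma cube_root_of_unity_primitive:
  fixes x :: complex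
  assumes "x ^ 3 = 1" "x \<noteq> 1" "\<not> 3 dvd t"
  shows "x ^ t \<noteq> 1"
proof -
  have "t = 3 * (t div 3) + t mod 3" by simp
  then have "x ^ t = (x ^ 3) ^ (t div 3) * x ^ (t mod 3)"
    by (metis power_add power_mult)
  then have eq: "x ^ t = x ^ (t mod 3)" using assms by simp
  have "t mod 3 = 1 \<or> t mod 3 = 2" using assms(3) by presburger
  moreover have "x ^ 2 \<noteq> 1"
  proof
    assume "x ^ 2 = 1"
    then have "x ^ 3 = x" by (simp add: power3_eq_cube power2_eq_square)
    then show False using assms by simp
  qed
  ultimately show ?thesis using eq assms(2) by auto
qed

lemma cube_root_of_unity_sum:
  fixes x :: complex
  assumes "x ^ 3 = 1" "x \<noteq> 1"
  shows "1 + x + x ^ 2 = 0"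
proof -
  have "(x - 1) * (1 + x + x ^ 2) = 0"
    using assms(1) by (simp add: power3_eq_cube power2_eq_square algebra_simps)
  then show ?thesis using assms(2) by simp
qed

text \<open>Five elements in three nonempty classes leave a singleton class, so \<open>K\<close> is a unit; a class of
  three units has a unit as its sum, and a class of two is determined by its sum.\<close>

lemma three_classes_opposite_pair:
  fixes w f :: "'b \<Rightarrow> complex"
  assumes A: "card A = 5" and nw: "\<And>a. a \<in> A \<Longrightarrow> norm (w a) = 1"
    and f: "\<And>a. a \<in> A \<Longrightarrow> f a ^ 3 = 1" and surj: "\<And>u. u ^ 3 = 1 \<Longrightarrow> \<exists>a\<in>A. f a = u"
    and t: "\<not> 3 dvd t" and K: "\<And>u. u ^ 3 = 1 \<Longrightarrow> (\<Sum>a\<in>{a\<in>A. f a = u}. w a) * u ^ t = K"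
  shows "\<exists>a\<in>A. \<exists>b\<in>A. w a + w b = 0"
proof -
  define U where "U = {u::complex. u ^ 3 = 1}"
  define c where "c u = card {a\<in>A. f a = u}" for u
  have finA: "finite A" using A by (simp add: card_ge_0_finite)
  have cU: "card U = 3" unfolding U_def by (rule card_roots_unity_eq) simp
  have finU: "finite U" using cU by (simp add: card_ge_0_finite)
  have sumc: "(\<Sum>u\<in>U. c u) = 5"
  proof -
    have "f ` A \<subseteq> U" using f by (auto simp: U_def)
    then have "(\<Sum>u\<in>U. \<Sum>a\<in>{a\<in>A. f a = u}. 1) = (\<Sum>a\<in>A. 1::nat)"
      by (rule sum.group[OF finA finU])
    then show ?thesis using A by (simp add: c_def)
  qed
  have c1: "c u \<ge> 1" if "u \<in> U" for u
  proof -
    obtain a where "a \<in> A" "f a = u" using surj[of u] \<open>u \<in> U\<close> unfolding U_def by blast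
    then have "{a\<in>A. f a = u} \<noteq> {}" by auto
    then show ?thesis using finA by (simp add: c_def card_gt_0_iff Suc_le_eq)
  qed
  have nU: "norm u = 1" if "u \<in> U" for u
    using that norm_root_of_unity[of u 3] by (simp add: U_def)
  obtain u1 where u1: "u1 \<in> U" "c u1 = 1"
  proof (rule ccontr)
    assume "\<not> thesis"
    then have "c u \<ge> 2" if "u \<in> U" for u using c1[OF that] that \<open>\<And>u1. u1 \<in> U \<Longrightarrow> c u1 = 1 \<Longrightarrow> thesis\<close>
      by (metis One_nat_def Suc_1 le_antisym not_less_eq_eq)
    then have "(\<Sum>u\<in>U. 2) \<le> (\<Sum>u\<in>U. c u)" by (intro sum_mono)
    then show False using sumc cU by simp
  qed
  obtain u2 where u2: "u2 \<in> U" "c u2 \<ge> 2"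
  proof (rule ccontr)
    assume "\<not> thesis"
    then have "c u \<le> 1" if "u \<in> U" for u using that \<open>\<And>u2. u2 \<in> U \<Longrightarrow> 2 \<le> c u2 \<Longrightarrow> thesis\<close>
      by (metis One_nat_def Suc_1 not_less_eq_eq)
    then have "(\<Sum>u\<in>U. c u) \<le> (\<Sum>u\<in>U. 1)" by (intro sum_mono)
    then show False using sumc cU by simp
  qed
  have "c u2 \<le> 3"
  proof -
    have "(\<Sum>u\<in>U - {u2}. 1) \<le> (\<Sum>u\<in>U - {u2}. c u)" using c1 by (intro sum_mono) auto
    moreover have "card (U - {u2}) = 2" using cU u2 finU by simp
    ultimately show ?thesis using sum.remove[OF finU u2(1), of c] sumc by simp
  qed
  then have c2: "c u2 = 2 \<or> c u2 = 3" using u2 by auto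
  obtain a where a: "{a\<in>A. f a = u1} = {a}" using u1 by (auto simp: c_def card_1_singleton_iff)
  have aA: "a \<in> A" using a by blast
  have wa: "w a * u1 ^ t = K" using K[of u1] u1 a by (simp add: U_def)
  have u10: "u1 \<noteq> 0" "u2 \<noteq> 0" using nU[OF u1(1)] nU[OF u2(1)] by auto
  define k where "k = (\<Sum>a\<in>{a\<in>A. f a = u2}. w a)"
  have k: "k * u2 ^ t = K" using K[of u2] u2 by (simp add: U_def k_def)
  have "norm (k * u2 ^ t) = norm (w a * u1 ^ t)" using k wa by simp
  then have nk: "norm k = 1" using nU u1 u2 nw aA by (simp add: norm_mult norm_power)
  from c2 show ?thesis
  proof
    assume "c u2 = 3"
    then obtain b1 b2 b3 where b: "{a\<in>A. f a = u2} = {b1, b2, b3}" "b1 \<noteq> b2" "b1 \<noteq> b3" "b2 \<noteq> b3"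
      by (auto simp: c_def card_3_iff)
    have bA: "b1 \<in> A" "b2 \<in> A" "b3 \<in> A" using b(1) by blast+
    have "k = w b1 + w b2 + w b3" using b by (simp add: k_def)
    then have "w b1 + w b2 = 0 \<or> w b1 + w b3 = 0 \<or> w b2 + w b3 = 0"
      using three_units_sum_unit nw bA nk by blast
    then show ?thesis using bA by blast
  next
    assume "c u2 = 2"
    then obtain b1 b2 where b: "{a\<in>A. f a = u2} = {b1, b2}" "b1 \<noteq> b2"
      by (auto simp: c_def card_2_iff)
    have bA: "b1 \<in> A" "b2 \<in> A" using b(1) by blast+
    have kb: "k = w b1 + w b2" using b by (simp add: k_def)
    have nz: "w b1 \<noteq> 0" "w b2 \<noteq> 0" "k \<noteq> 0" using nw bA nk by fastforce+
    \<comment> \<open>As \<open>k\<close> has norm 1, conjugating \<open>k = w b1 + w b2\<close>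
      fixes the product as \<open>k ^ 2\<close>, so the pair consists of the roots of
      \<open>X ^ 2 - k * X + k ^ 2\<close>.\<close>
    have "cnj k = inverse (w b1) + inverse (w b2)" using kb nw bA by (simp add: cnj_norm_1)
    then have "inverse k = inverse (w b1) + inverse (w b2)" using nk by (simp add: cnj_norm_1)
    then have "w b1 * w b2 = k * (w b1 + w b2)" using nz by (simp add: field_simps)
    then have prod: "w b1 * w b2 = k ^ 2" using kb by (simp add: power2_eq_square)
    \<comment> \<open>\<open>w a\<close> is \<open>k\<close> times the primitive cube root of unity
      \<open>v\<close>, which makes \<open>- w a\<close> a root of the same quadratic.\<close>
    define v where "v = (u2 / u1) ^ t"
    have ne: "u2 / u1 \<noteq> 1"
    proof
      assume "u2 / u1 = 1"
      then have "u1 = u2" using u10 by simp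
      then show False using u1 u2 by simp
    qed
    have x3: "(u2 / u1) ^ 3 = 1" using u1 u2 by (simp add: U_def power_divide)
    have v1: "v \<noteq> 1" unfolding v_def by (rule cube_root_of_unity_primitive[OF x3 ne t])
    have "v ^ 3 = ((u2 / u1) ^ 3) ^ t" by (simp only: v_def mult.commute flip: power_mult)
    then have "v ^ 3 = 1" using x3 by simp
    then have v: "1 + v + v ^ 2 = 0" using v1 by (rule cube_root_of_unity_sum)
    have "w a = k * v"
      using wa k u10 by (simp add: v_def power_divide field_simps)
    then have "(w a + w b1) * (w a + w b2) = k ^ 2 * (1 + v + v ^ 2)"
    proof -
      have "(w a + w b1) * (w a + w b2) = w a ^ 2 + w a * (w b1 + w b2) + w b1 * w b2"
        by (simp add: algebra_simps power2_eq_square)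
      also have "\<dots> = (k * v) ^ 2 + k * v * k + k ^ 2"
        unfolding prod kb[symmetric] \<open>w a = k * v\<close> ..
      finally show ?thesis by (simp add: algebra_simps power2_eq_square)
    qed
    then have "w a + w b1 = 0 \<or> w a + w b2 = 0" using v by simp
    then show ?thesis using aA bA by blast
  qed
qed

text \<open>Scaled so that one term is 1, and without opposite pairs, the sum has no proper
  vanishing subsum, since the subsum or its complement would have at most two terms. For the least
  common exponent \<open>N\<close> and a prime \<open>p\<close> dividing it, all \<open>p\<close>
  classes are then inhabited and \<open>p\<close> divides \<open>N\<close> only once. An odd such
  \<open>p\<close> is 3 or 5; 3 yields an opposite pair and 5 a pentagon.\<close>

theorem sum_five_roots_of_unity:
  fixes z :: "'b \<Rightarrow> complex"
  assumes A: "card A = 5" and z: "\<And>a. a \<in> A \<Longrightarrow> \<exists>n>0. z a ^ n = 1" and s: "(\<Sum>a\<in>A. z a) = 0"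
  shows "(inj_on z A \<and> (\<forall>a\<in>A. \<forall>b\<in>A. z a ^ 5 = z b ^ 5)) \<or> (\<exists>a\<in>A. \<exists>b\<in>A. z a + z b = 0)"
proof (rule disjCI)
  assume "\<not> (\<exists>a\<in>A. \<exists>b\<in>A. z a + z b = 0)"
  then have zopp: "z a + z b \<noteq> 0" if "a \<in> A" "b \<in> A" for a b using that by blast
  have finA: "finite A" using A by (simp add: card_ge_0_finite)
  obtain a0 where a0: "a0 \<in> A" using A by fastforce
  have nz: "norm (z a) = 1" if "a \<in> A" for a using z[OF that] norm_root_of_unity by blast
  have z0: "z a0 \<noteq> 0" using nz[OF a0] by auto
  define w where "w a = z a / z a0" for a
  have zw: "z a = w a * z a0" for a using z0 by (simp add: w_def)
  have wa0: "w a0 = 1" using z0 by (simp add: w_def)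
  have nw: "norm (w a) = 1" if "a \<in> A" for a using nz that a0 by (simp add: w_def norm_divide)
  have sw: "(\<Sum>a\<in>A. w a) = 0" using s by (simp add: w_def flip: sum_divide_distrib)
  have opp: "w a + w b \<noteq> 0" if "a \<in> A" "b \<in> A" for a b
    using zopp[OF that] z0 by (simp add: w_def flip: add_divide_distrib)
  define good where "good n \<longleftrightarrow> n > 0 \<and> (\<forall>a\<in>A. w a ^ n = 1)" for n :: nat
  have "\<exists>n. good n"
  proof -
    obtain n where n: "\<And>a. a \<in> A \<Longrightarrow> n a > 0 \<and> z a ^ n a = (1::complex)" using z by metis
    have "z a ^ (\<Prod>b\<in>A. n b) = 1" if "a \<in> A" for a
      using n[OF that] that by (simp add: prod.remove[OF finA that] power_mult)
    then have "good (\<Prod>b\<in>A. n b)" using n a0 by (simp add: good_def w_def power_divide prod_pos)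
    then show ?thesis by blast
  qed
  define N where "N = (LEAST n. good n)"
  have gN: "good N" unfolding N_def using \<open>\<exists>n. good n\<close> by (rule LeastI_ex)
  have minN: "\<not> good n" if "n < N" for n using that not_less_Least unfolding N_def by blast
  have N0: "N > 0" and wN: "\<And>a. a \<in> A \<Longrightarrow> w a ^ N = 1" using gN by (auto simp: good_def)
  have small: "B = {}" if "B \<subseteq> A" "card B \<le> 2" "(\<Sum>a\<in>B. w a) = 0" for B
  proof (rule ccontr)
    assume "B \<noteq> {}"
    then have "card B \<noteq> 0" using that finA finite_subset by fastforce
    then consider "card B = 1" | "card B = 2" using \<open>card B \<le> 2\<close> by linarith
    then show False
    proof cases
      case 1
      then obtain b where "B = {b}" by (auto simp: card_1_singleton_iff)
      then show False using that nw by fastforce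
    next
      case 2
      then obtain b c where "B = {b, c}" "b \<noteq> c" by (auto simp: card_2_iff)
      then show False using that opp by auto
    qed
  qed
  have part: "B = {} \<or> B = A" if "B \<subseteq> A" "(\<Sum>a\<in>B. w a) = 0" for B
  proof -
    have "(\<Sum>a\<in>A - B. w a) = 0" using sum_diff[OF finA that(1), of w] that sw by simp
    moreover have "card (A - B) + card B = 5"
      using A finA that by (metis card_Diff_subset card_mono finite_subset le_add_diff_inverse2)
    then have "card B \<le> 2 \<or> card (A - B) \<le> 2" by linarith
    ultimately show ?thesis using small[of B] small[of "A - B"] that by blast
  qed
  \<comment> \<open>If \<open>D\<close> were 0, the class of 1 would be a nonempty vanishing subsum,
    hence all of \<open>A\<close>, and \<open>M\<close> would be a smaller common exponent than
    \<open>N\<close>. A nonzero \<open>D\<close> forces every class to be nonempty.\<close>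
  have classes: "\<not> p dvd M \<and> (\<exists>t K. \<not> p dvd t \<and>
      (\<forall>u. u ^ p = 1 \<longrightarrow> (\<exists>a\<in>A. w a ^ M = u) \<and> (\<Sum>a\<in>{a\<in>A. w a ^ M = u}. w a) * u ^ t = K))"
    if p: "prime p" "N = p * M" for p M
  proof -
    have p1: "p > 1" using p prime_gt_1_nat by blast
    have M0: "M > 0" using p N0 by auto
    obtain t D where t: "\<not> p dvd t"
      and D: "\<And>u. u ^ p = 1 \<Longrightarrow> of_nat p * (\<Sum>a\<in>{a\<in>A. w a ^ M = u}. w a) * u ^ t = D"
      and D0: "p dvd M \<Longrightarrow> D = 0"
      using root_of_unity_class_sums[OF finA p(1) M0 wN[unfolded p(2)] sw] by blast
    have "D \<noteq> 0"
    proof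
      assume "D = 0"
      then have "(\<Sum>a\<in>{a\<in>A. w a ^ M = 1}. w a) = 0" using D[of 1] p1 by simp
      then have "{a\<in>A. w a ^ M = 1} = {} \<or> {a\<in>A. w a ^ M = 1} = A" by (intro part) auto
      then have "{a\<in>A. w a ^ M = 1} = A" using a0 wa0 by auto
      then have "good M" using M0 by (auto simp: good_def)
      moreover have "M < N" using p p1 M0 by simp
      ultimately show False using minN by blast
    qed
    moreover have "\<exists>a\<in>A. w a ^ M = u" if "u ^ p = 1" for u
    proof (rule ccontr)
      assume "\<not> ?thesis"
      then have e: "{a\<in>A. w a ^ M = u} = {}" by auto
      show False using D[OF that] \<open>D \<noteq> 0\<close> unfolding e by simp
    qed
    moreover have "(\<Sum>a\<in>{a\<in>A. w a ^ M = u}. w a) * u ^ t = D / of_nat p" if "u ^ p = 1" for u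
      using D[OF that] p1 by (simp add: field_simps)
    ultimately show ?thesis using t D0 by blast
  qed
  have "\<not> 4 dvd N"
  proof
    assume "4 dvd N"
    then obtain m where "N = 2 * (2 * m)" by (auto elim!: dvdE)
    then show False using classes[of 2 "2 * m"] by auto
  qed
  have "\<not> N dvd 2"
  proof
    assume "N dvd 2"
    then have w2: "w a ^ 2 = 1" if "a \<in> A" for a
      using wN[OF that] by (metis dvdE power_mult power_one)
    have "w a = 1" if "a \<in> A" for a
    proof -
      have "w a = 1 \<or> w a = - 1" using w2[OF that] by (simp add: power2_eq_1_iff)
      then show ?thesis using opp[OF that a0] wa0 by auto
    qed
    then have "(\<Sum>a\<in>A. w a) = 5" using A by simp
    then show False using sw by simp
  qed
  have "\<exists>p. prime p \<and> odd p \<and> p dvd N"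
  proof -
    \<comment> \<open>\<open>n\<close> is the odd part of \<open>N\<close>, because 4 does not
      divide \<open>N\<close>.\<close>
    define n where "n = (if even N then N div 2 else N)"
    have "odd n" using \<open>\<not> 4 dvd N\<close> unfolding n_def by presburger
    have "n dvd N" by (auto simp: n_def)
    have "n \<noteq> 1" using \<open>\<not> N dvd 2\<close> by (auto simp: n_def split: if_splits)
    then obtain p where "prime p" "p dvd n" using prime_factor_nat by blast
    then show ?thesis using \<open>odd n\<close> \<open>n dvd N\<close> by (meson dvd_trans)
  qed
  then obtain p M where p: "prime p" "odd p" and pM: "N = p * M" by (auto elim: dvdE)
  obtain t K where t: "\<not> p dvd t"
    and surj: "\<And>u. u ^ p = 1 \<Longrightarrow> \<exists>a\<in>A. w a ^ M = u"
    and K: "\<And>u. u ^ p = 1 \<Longrightarrow> (\<Sum>a\<in>{a\<in>A. w a ^ M = u}. w a) * u ^ t = K"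
    using classes[OF p(1) pM] by blast
  have p0: "p > 0" using p prime_gt_0_nat by blast
  have wMp: "(w a ^ M) ^ p = 1" if "a \<in> A" for a
    using wN[OF that] pM by (metis power_mult mult.commute)
  let ?U = "{u::complex. u ^ p = 1}"
  have cU: "card ?U = p" using p0 by (rule card_roots_unity_eq)
  have img: "(\<lambda>a. w a ^ M) ` A = ?U" using surj wMp by auto
  then have "p \<le> 5" using card_image_le[OF finA, of "\<lambda>a. w a ^ M"] cU A by simp
  then have "p \<in> {0, 1, 2, 3, 4, 5}" by auto
  then have "p = 3 \<or> p = 5" using p by auto
  then show "inj_on z A \<and> (\<forall>a\<in>A. \<forall>b\<in>A. z a ^ 5 = z b ^ 5)"
  proof
    assume "p = 3"
    then have "\<exists>a\<in>A. \<exists>b\<in>A. w a + w b = 0"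
      using three_classes_opposite_pair[OF A nw, where f = "\<lambda>a. w a ^ M" and t = t and K = K] wMp surj t K by simp
    then show ?thesis using opp by blast
  next
    assume p5: "p = 5"
    then have inj: "inj_on (\<lambda>a. w a ^ M) A"
      using img cU A finA by (intro eq_card_imp_inj_on) auto
    then have "inj_on z A" by (auto simp: inj_on_def w_def)
    \<comment> \<open>Every class is a single element, and its label \<open>u\<close> disappears in
      the fifth power.\<close>
    moreover have "w a ^ 5 = K ^ 5" if "a \<in> A" for a
    proof -
      define u where "u = w a ^ M"
      have u: "u ^ 5 = 1" using wMp[OF that] p5 by (simp add: u_def)
      have "{b\<in>A. w b ^ M = u} = {a}" using inj that by (auto simp: inj_on_def u_def)
      then have "w a * u ^ t = K" using K[of u] u p5 by simp
      then have "K ^ 5 = w a ^ 5 * (u ^ 5) ^ t"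
        by (metis power_mult_distrib power_mult mult.commute)
      then show ?thesis using u by simp
    qed
    then have "z a ^ 5 = K ^ 5 * z a0 ^ 5" if "a \<in> A" for a
      using that by (subst zw) (simp only: power_mult_distrib)
    then have "\<forall>a\<in>A. \<forall>b\<in>A. z a ^ 5 = z b ^ 5" by simp
    ultimately show ?thesis by blast
  qed
qed

section \<open>Orthogonal rows of length five without a pentagon\<close>

lemma two_units_sum_0:
  fixes x y :: complex
  assumes "norm x = 1" "x + y = 0"
  shows "x ^ 2 = y ^ 2" "x \<noteq> y"
  using assms by (auto simp: add_eq_0_iff2)

text \<open>Conjugating the sum shows that the second elementary symmetric function vanishes along
  with the first, so the terms are the cube roots of unity up to a scalar.\<close>

lemma three_units_sum_0:
  fixes x y z :: complex
  assumes "norm x = 1" "norm y = 1" "norm z = 1" "x + y + z = 0"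
  shows "x ^ 2 + x * y + y ^ 2 = 0" "x ^ 3 = y ^ 3" "x \<noteq> y"
proof -
  have nz: "x \<noteq> 0" "y \<noteq> 0" "z \<noteq> 0" using assms by auto
  have z: "z = - x - y" using assms(4) by (simp add: algebra_simps eq_neg_iff_add_eq_0)
  have "cnj x + cnj y + cnj z = 0" using assms(4) by (metis complex_cnj_add complex_cnj_zero)
  then have "inverse x + inverse y + inverse z = 0"
    using assms by (simp add: cnj_norm_1)
  then have "x * y + (x + y) * z = 0" using nz by (simp add: field_simps)
  moreover have "x ^ 2 + x * y + y ^ 2 = - (x * y + (x + y) * z)"
    unfolding z by (simp add: algebra_simps power2_eq_square)
  ultimately show eq: "x ^ 2 + x * y + y ^ 2 = 0" by simp
  have "x ^ 3 - y ^ 3 = (x - y) * (x ^ 2 + x * y + y ^ 2)"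
    by (simp add: algebra_simps power2_eq_square power3_eq_cube)
  then show "x ^ 3 = y ^ 3" using eq by simp
  show "x \<noteq> y"
  proof
    assume "x = y"
    then have "3 * x ^ 2 = 0" using eq by (simp add: power2_eq_square)
    then show False using nz by simp
  qed
qed

text \<open>Equal norms of sum and difference mean that \<open>y\<close> and \<open>z\<close> are
  perpendicular in the plane, so \<open>y / z\<close> is a square root of -1.\<close>

lemma units_orthogonal:
  fixes y z :: complex
  assumes "norm y = 1" "norm z = 1" "norm (y - z) = norm (y + z)"
  shows "y ^ 2 = - (z ^ 2)"
proof -
  have nz: "y \<noteq> 0" "z \<noteq> 0" using assms by auto
  have "(y - z) * cnj (y - z) = (y + z) * cnj (y + z)"
    using assms(3) by (simp only: complex_norm_square[symmetric])
  then have "(y - z) * (inverse y - inverse z) = (y + z) * (inverse y + inverse z)"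
    using assms by (simp add: cnj_norm_1)
  then have "2 * (y ^ 2 + z ^ 2) = 0"
    using nz by (simp add: field_simps power2_eq_square)
  then show ?thesis by (simp add: eq_neg_iff_add_eq_0 del: distrib_left_numeral)
qed

text \<open>Equality would force the real part of \<open>y / z\<close> to be \<open>3 / 2\<close>,
  too large for a number of norm 1.\<close>

lemma units_norm_diff_neq:
  fixes y z :: complex
  assumes "norm y = 1" "norm z = 1"
  shows "norm (y - z) \<noteq> norm (y - 2 * z)"
proof
  assume eq: "norm (y - z) = norm (y - 2 * z)"
  have nz: "y \<noteq> 0" "z \<noteq> 0" using assms by auto
  have "(y - z) * cnj (y - z) = (y - 2 * z) * cnj (y - 2 * z)"
    using eq by (simp only: complex_norm_square[symmetric])
  then have "(y - z) * (inverse y - inverse z) = (y - 2 * z) * (inverse y - 2 * inverse z)"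
    using assms by (simp add: cnj_norm_1)
  then have "y ^ 2 + z ^ 2 = 3 * (y * z)"
    using nz by (simp add: field_simps power2_eq_square)
  then have "norm (y ^ 2 + z ^ 2) = 3" using assms by (simp add: norm_mult)
  moreover have "norm (y ^ 2 + z ^ 2) \<le> norm (y ^ 2) + norm (z ^ 2)" by (rule norm_triangle_ineq)
  ultimately show False using assms by (simp add: norm_power)
qed

text \<open>\<open>3^n (t^n + t^-n)\<close> is an integer congruent to \<open>5^n\<close> modulo 3, whereas for \<open>t^n = 1\<close>
  it would be \<open>2 * 3^n\<close>.\<close>

lemma root_of_unity_not_root:
  fixes t :: complex
  assumes "t ^ n = 1" "n > 0"
  shows "3 * t ^ 2 - 5 * t + 3 \<noteq> 0"
proof
  assume eq: "3 * t ^ 2 - 5 * t + 3 = 0"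
  then have t0: "t \<noteq> 0" by auto
  have eq': "3 * (t + inverse t) = 5"
    using eq t0 by (simp add: field_simps power2_eq_square)
  define s where "s k = 3 ^ k * (t ^ k + inverse t ^ k)" for k
  \<comment> \<open>This follows from \<open>3 * (t + inverse t) = 5\<close>. Modulo 3 the recursion
    is multiplication by 5, so 3 never divides a value.\<close>
  have rec: "s (Suc (Suc k)) = 5 * s (Suc k) - 9 * s k" for k
  proof -
    have "5 * s (Suc k) = 3 * (t + inverse t) * s (Suc k)" by (simp only: eq')
    also have "\<dots> = s (Suc (Suc k)) + 9 * s k"
      using t0 by (simp add: s_def field_simps)
    finally show ?thesis by simp
  qed
  have "\<exists>a b::int. s k = of_int a \<and> s (Suc k) = of_int b \<and> \<not> 3 dvd b" for k
  proof (induction k)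
    case 0
    have "s 0 = of_int 2" "s (Suc 0) = of_int 5" using eq' by (simp_all add: s_def)
    moreover have "\<not> 3 dvd (5::int)" by presburger
    ultimately show ?case by blast
  next
    case (Suc k)
    then obtain a b :: int where ab: "s k = of_int a" "s (Suc k) = of_int b" "\<not> 3 dvd b" by blast
    have "s (Suc (Suc k)) = of_int (5 * b - 9 * a)" by (simp add: rec ab)
    moreover have "\<not> 3 dvd 5 * b - 9 * a" using ab(3) by presburger
    ultimately show ?case using ab by blast
  qed
  from this[of "n - 1"] obtain b :: int where b: "s n = of_int b" "\<not> 3 dvd b"
    using assms(2) by auto
  have "s n = of_int (3 ^ n * 2)" using assms(1) by (simp add: s_def power_inverse)
  then have "b = 3 ^ n * 2" using b by (metis of_int_eq_iff)
  then show False using b(2) assms(2) by (simp add: dvd_power)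
qed

lemma primitive_cube_root:
  fixes w :: complex
  assumes "1 + w + w ^ 2 = 0"
  shows "w ^ 2 = - 1 - w" "w * w ^ 2 = 1" "w ^ 3 = 1" "norm w = 1" "cnj w = w ^ 2"
proof -
  show w2: "w ^ 2 = - 1 - w" using assms by (simp add: algebra_simps eq_neg_iff_add_eq_0)
  have "w * w ^ 2 = - w - w ^ 2" by (subst w2) (simp add: algebra_simps power2_eq_square)
  then show w3: "w * w ^ 2 = 1" by (simp add: w2)
  then show "w ^ 3 = 1" by (simp add: power3_eq_cube power2_eq_square mult.assoc)
  then show "norm w = 1" by (rule norm_root_of_unity) simp
  then show "cnj w = w ^ 2" using w3 by (simp add: cnj_norm_1 inverse_unique)
qed

text \<open>The quadratic satisfied by \<open>y\<close> factors as
  \<open>(y - w * x) * (y - w ^ 2 * x)\<close>, leaving the two orientations of the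
  triangle.\<close>

lemma two_thirds_of_cube_roots:
  fixes x y z w :: complex
  assumes "norm x = 1" "norm y = 1" "norm z = 1" "x + y + z = 0" and w: "1 + w + w ^ 2 = 0"
  shows "y = w * x \<and> z = w ^ 2 * x \<or> y = w ^ 2 * x \<and> z = w * x"
proof -
  have z: "z = - x - y" using assms(4) by (simp add: algebra_simps eq_neg_iff_add_eq_0)
  note w2 = primitive_cube_root(1)[OF w] and w3 = primitive_cube_root(2)[OF w]
  have "x ^ 2 + x * y + y ^ 2 = 0" using three_units_sum_0 assms by blast
  moreover have "(y - w * x) * (y - w ^ 2 * x) = x ^ 2 + x * y + y ^ 2"
  proof -
    have "(y - w * x) * (y - w ^ 2 * x) = y ^ 2 - (w + w ^ 2) * (x * y) + (w * w ^ 2) * x ^ 2"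
      by (simp add: algebra_simps power2_eq_square)
    moreover have "w + w ^ 2 = - 1" by (simp add: w2)
    ultimately show ?thesis using w3 by simp
  qed
  ultimately have "y = w * x \<or> y = w ^ 2 * x" by simp
  then show ?thesis
  proof
    assume y: "y = w * x"
    have "z = (- 1 - w) * x" by (simp add: z y algebra_simps)
    then show ?thesis using y by (simp add: w2)
  next
    assume y: "y = w ^ 2 * x"
    have "z = (- 1 - w ^ 2) * x" by (simp add: z y algebra_simps)
    then show ?thesis using y by (simp add: w2)
  qed
qed

text \<open>Relative to a row \<open>(1, -1, b, b w, b w^2)\<close>, every root-of-unity row
  orthogonal to it and to \<open>(1, 1, 1, 1, 1)\<close> that contains an opposite pair has this shape, up to
  exchanging the first two entries.\<close>

definition twisted_row :: "complex \<Rightarrow> complex \<Rightarrow> complex \<Rightarrow> complex \<Rightarrow> complex \<Rightarrow> complex \<Rightarrow> bool" where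
  "twisted_row w p q r s t \<longleftrightarrow> p ^ 2 = - (q ^ 2) \<and>
     (r = - p \<and> s = w ^ 2 * q \<and> t = w * q \<or>
      s = - p \<and> t = w ^ 2 * q \<and> r = w * q \<or>
      t = - p \<and> r = w ^ 2 * q \<and> s = w * q)"

text \<open>Next to the pair \<open>p\<close>, \<open>r\<close> the entries \<open>q\<close>,
  \<open>s\<close>, \<open>t\<close> form a triangle of one of two orientations. Taking norms in
  \<open>orth\<close> removes \<open>c\<close>: one orientation gives
  \<open>norm (p - q) = norm (p - 2 * q)\<close>, which is impossible, the other
  \<open>norm (p - q) = norm (p + q)\<close>.\<close>

lemma twisted_rowI:
  fixes p q r s t w c :: complex
  assumes units: "norm p = 1" "norm q = 1" "norm r = 1" "norm s = 1" "norm t = 1"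
    and w: "1 + w + w ^ 2 = 0" and c: "norm c = 1"
    and sum: "p + q + r + s + t = 0" and orth: "p - q + c * (r + w ^ 2 * s + w * t) = 0"
    and pr: "p + r = 0"
  shows "p ^ 2 = - (q ^ 2) \<and> r = - p \<and> s = w ^ 2 * q \<and> t = w * q"
proof -
  note w2 = primitive_cube_root(1)[OF w] and w3 = primitive_cube_root(2)[OF w]
  have r: "r = - p" using pr by (simp add: eq_neg_iff_add_eq_0 add.commute)
  have qst: "q + s + t = 0" using sum pr by (simp add: r)
  have "p - q = - (c * (r + w ^ 2 * s + w * t))" using orth by (simp add: eq_neg_iff_add_eq_0)
  then have n: "norm (p - q) = norm (r + w ^ 2 * s + w * t)" using c by (simp add: norm_mult)
  have "\<not> (s = w * q \<and> t = w ^ 2 * q)"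
  proof
    assume st: "s = w * q \<and> t = w ^ 2 * q"
    have "r + w ^ 2 * s + w * t = - p + 2 * (w * w ^ 2) * q" by (simp add: r st)
    then have "norm (p - q) = norm (- (p - 2 * q))" using n w3 by simp
    then show False using units_norm_diff_neq[OF units(1,2)] by (simp only: norm_minus_cancel)
  qed
  then have st: "s = w ^ 2 * q" "t = w * q"
    using two_thirds_of_cube_roots[OF units(2,4,5) qst w] by auto
  have "w ^ 2 * s + w * t = (w * (w * w ^ 2) + w ^ 2) * q"
    by (simp add: st algebra_simps power2_eq_square)
  also have "\<dots> = - q" by (simp only: w3) (simp add: w2 algebra_simps)
  finally have "r + w ^ 2 * s + w * t = - (p + q)" by (simp add: r algebra_simps)
  then have "norm (p - q) = norm (p + q)" using n by (simp only: norm_minus_cancel)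
  then show ?thesis using units_orthogonal[OF units(1,2)] r st by simp
qed

text \<open>If \<open>q = - p\<close>, then \<open>r\<close>, \<open>s\<close>, \<open>t\<close>
  form a triangle and the bracket multiplied by \<open>c\<close> has norm 3 or 0, while
  \<open>p - q\<close> has norm 2.\<close>

lemma no_opposite_pair_12:
  fixes p q r s t w c :: complex
  assumes units: "norm p = 1" "norm q = 1" "norm r = 1" "norm s = 1" "norm t = 1"
    and w: "1 + w + w ^ 2 = 0" and c: "norm c = 1"
    and sum: "p + q + r + s + t = 0" and orth: "p - q + c * (r + w ^ 2 * s + w * t) = 0"
  shows "p + q \<noteq> 0"
proof
  assume pq: "p + q = 0"
  note w2 = primitive_cube_root(1)[OF w] and w3 = primitive_cube_root(2)[OF w]
  have q: "q = - p" using pq by (simp add: eq_neg_iff_add_eq_0 add.commute)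
  have "r + s + t = 0" using sum pq by simp
  then have "s = w * r \<and> t = w ^ 2 * r \<or> s = w ^ 2 * r \<and> t = w * r"
    by (rule two_thirds_of_cube_roots[OF units(3-5) _ w])
  then have "r + w ^ 2 * s + w * t \<in> {3 * r, 0}"
  proof
    assume st: "s = w * r \<and> t = w ^ 2 * r"
    have "r + w ^ 2 * s + w * t = (1 + 2 * (w * w ^ 2)) * r" by (simp add: st algebra_simps)
    then show ?thesis using w3 by simp
  next
    assume st: "s = w ^ 2 * r \<and> t = w * r"
    have "r + w ^ 2 * s + w * t = (1 + w * (w * w ^ 2) + w ^ 2) * r"
      by (simp add: st algebra_simps power2_eq_square)
    then show ?thesis using w3 w by simp
  qed
  moreover have "2 * p = - (c * (r + w ^ 2 * s + w * t))" using orth q by (simp add: eq_neg_iff_add_eq_0)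
  then have "norm (2 * p) = norm (r + w ^ 2 * s + w * t)" using c by (simp add: norm_mult)
  moreover have "norm (2 * p) = 2" "norm (3 * r) = 3" using units by (simp_all add: norm_mult)
  ultimately show False by (metis empty_iff insertE norm_zero numeral_eq_iff semiring_norm(89) zero_neq_numeral)
qed

text \<open>If \<open>s = - r\<close>, then \<open>p\<close>, \<open>q\<close>, \<open>t\<close>
  form a triangle and \<open>norm (p - q) ^ 2 = 3\<close>. Comparison with the bracket in
  \<open>orth\<close> gives a quartic equation for \<open>r / t\<close>, whose solutions do have
  norm 1 but are not roots of unity.\<close>

lemma no_opposite_pair_34:
  fixes p q r s t w c :: complex
  assumes units: "norm p = 1" "norm q = 1" "norm r = 1" "norm s = 1" "norm t = 1"
    and w: "1 + w + w ^ 2 = 0" and c: "norm c = 1"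
    and sum: "p + q + r + s + t = 0" and orth: "p - q + c * (r + w ^ 2 * s + w * t) = 0"
    and roots: "\<exists>n>0. r ^ n = 1" "\<exists>n>0. t ^ n = 1"
  shows "r + s \<noteq> 0"
proof
  assume rs: "r + s = 0"
  note w2 = primitive_cube_root(1)[OF w] and w3 = primitive_cube_root(2)[OF w]
  note cw = primitive_cube_root(5)[OF w]
  have s: "s = - r" using rs by (simp add: eq_neg_iff_add_eq_0 add.commute)
  have "t + p + q = 0" using sum rs by (simp add: s algebra_simps)
  then have "p = w * t \<and> q = w ^ 2 * t \<or> p = w ^ 2 * t \<and> q = w * t"
    by (rule two_thirds_of_cube_roots[OF units(5,1,2) _ w])
  then have "(p - q) * cnj (p - q) = ((w - w ^ 2) * cnj (w - w ^ 2)) * (t * cnj t)"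
    by (auto simp: algebra_simps)
  also have "t * cnj t = 1" using units by (simp only: complex_norm_square[symmetric]) simp
  also have "(w - w ^ 2) * cnj (w - w ^ 2) = 2 * (w * w ^ 2) - w ^ 2 - w * (w * w ^ 2)"
    unfolding complex_cnj_diff complex_cnj_power cw
    using w3 by (simp add: algebra_simps power2_eq_square)
  also have "\<dots> = 3" unfolding w3 by (simp add: w2)
  finally have pq: "(p - q) * cnj (p - q) = 3" by simp
  have "p - q = - (c * (r + w ^ 2 * s + w * t))" using orth by (simp add: eq_neg_iff_add_eq_0)
  then have n: "norm (p - q) = norm (r + w ^ 2 * s + w * t)" using c by (simp add: norm_mult)
  have "r + w ^ 2 * s + w * t = (2 + w) * r + w * t" by (simp add: s w2 algebra_simps)
  then have "((2 + w) * r + w * t) * cnj ((2 + w) * r + w * t) = 3"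
    using n pq by (metis complex_norm_square)
  then have e: "((2 + w) * r + w * t) * ((1 - w) * inverse r + (- 1 - w) * inverse t) = 3"
    using units by (simp add: cw w2 cnj_norm_1 algebra_simps)
  have nz: "r \<noteq> 0" "t \<noteq> 0" using units by auto
  define u where "u = r / t"
  have u0: "u \<noteq> 0" using nz by (simp add: u_def)
  have ru: "r = u * t" using nz by (simp add: u_def)
  have ww: "w * w = - 1 - w" using w2 by (simp add: power2_eq_square)
  have "((2 + w) * u + w) * ((1 - w) + (- 1 - w) * u) = 3 * u"
  proof -
    have "(2 + w) * r + w * t = t * ((2 + w) * u + w)" by (simp add: ru algebra_simps)
    moreover have "(1 - w) * inverse r + (- 1 - w) * inverse t
        = inverse t * inverse u * ((1 - w) + (- 1 - w) * u)"
      using u0 nz by (simp add: ru field_simps)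
    ultimately have "(t * inverse t) * (((2 + w) * u + w) * ((1 - w) + (- 1 - w) * u)) * inverse u = 3"
      using e by (simp only: mult_ac)
    then show ?thesis using nz u0 by (simp add: field_simps)
  qed
  moreover have "((2 + w) * u + w) * ((1 - w) + (- 1 - w) * u)
     = - (2 + 3 * w + w * w) * u ^ 2 + (2 - w - w * w - w - w * w) * u + (w - w * w)"
    by (simp add: algebra_simps power2_eq_square)
  ultimately have "- (1 + 2 * w) * u ^ 2 + 4 * u + (1 + 2 * w) = 3 * u"
    unfolding ww by (simp add: algebra_simps)
  then have "(1 + 2 * w) * (u ^ 2 - 1) = u" by (simp add: algebra_simps)
  \<comment> \<open>Squaring trades \<open>1 + 2 * w\<close>, a square root of -3, for a rational
    coefficient.\<close>
  then have "(1 + 2 * w) ^ 2 * (u ^ 2 - 1) ^ 2 = u ^ 2" by (metis power_mult_distrib)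
  moreover have "(1 + 2 * w) ^ 2 = 1 + 4 * w + 4 * (w * w)" by (simp add: power2_eq_square algebra_simps)
  then have "(1 + 2 * w) ^ 2 = - 3" by (simp add: ww)
  ultimately have "- 3 * (u ^ 2 - 1) ^ 2 = u ^ 2" by simp
  then have "3 * (u ^ 2) ^ 2 - 5 * u ^ 2 + 3 = 0"
    by (simp add: algebra_simps power2_eq_square)
  moreover obtain n m where "n > 0" "m > 0" "r ^ n = 1" "t ^ m = 1" using roots by blast
  then have "r ^ (n * m) = 1" "t ^ (n * m) = 1" "n * m > 0"
    by (simp_all add: power_mult) (metis power_mult mult.commute power_one)
  then have "u ^ (n * m) = 1" by (simp add: u_def power_divide)
  then have "(u ^ 2) ^ (n * m) = 1" by (metis power_mult mult.commute power_one)
  ultimately show False using root_of_unity_not_root[of "u ^ 2" "n * m"] \<open>n * m > 0\<close> by blast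
qed

text \<open>A cyclic shift of \<open>r\<close>, \<open>s\<close>, \<open>t\<close> is absorbed into
  \<open>c\<close> by a cube root of unity, and an exchange of \<open>p\<close> and \<open>q\<close>
  by a change of sign, so the three preceding lemmas cover every position of an opposite
  pair.\<close>

lemma twisted_row_cases:
  fixes p q r s t w c :: complex
  assumes units: "norm p = 1" "norm q = 1" "norm r = 1" "norm s = 1" "norm t = 1"
    and w: "1 + w + w ^ 2 = 0" and c: "norm c = 1"
    and sum: "p + q + r + s + t = 0" and orth: "p - q + c * (r + w ^ 2 * s + w * t) = 0"
    and roots: "\<exists>n>0. r ^ n = 1" "\<exists>n>0. s ^ n = 1" "\<exists>n>0. t ^ n = 1"
    and opp: "\<exists>x\<in>{p, q, r, s, t}. \<exists>y\<in>{p, q, r, s, t}. x + y = 0"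
  shows "twisted_row w p q r s t \<or> twisted_row w q p r s t"
proof -
  note w3 = primitive_cube_root(3)[OF w] and nw = primitive_cube_root(4)[OF w]
  have w4: "w ^ 2 * w ^ 2 = w" "w * w ^ 2 = 1" "w ^ 2 * w = 1"
    using w3 by (simp_all add: power2_eq_square power3_eq_cube mult.assoc)
  define c1 where "c1 = c * w ^ 2"
  define c2 where "c2 = c * w"
  have nc: "norm c1 = 1" "norm c2 = 1" "norm (- c) = 1" "norm (- c1) = 1" "norm (- c2) = 1"
    using c nw by (simp_all add: c1_def c2_def norm_mult norm_power)
  have "c1 * (s + w ^ 2 * t + w * r) = c * (r + w ^ 2 * s + w * t)"
  proof -
    have "c1 * (s + w ^ 2 * t + w * r) = c * (w ^ 2 * s + (w ^ 2 * w ^ 2) * t + (w * w ^ 2) * r)"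
      by (simp add: c1_def algebra_simps)
    then show ?thesis using w4 by (simp add: algebra_simps)
  qed
  then have orth1: "p - q + c1 * (s + w ^ 2 * t + w * r) = 0" using orth by simp
  have "c2 * (t + w ^ 2 * r + w * s) = c * (r + w ^ 2 * s + w * t)"
  proof -
    have "c2 * (t + w ^ 2 * r + w * s) = c * (w * t + (w * w ^ 2) * r + (w * w) * s)"
      by (simp add: c2_def algebra_simps)
    then show ?thesis using w4 by (simp add: algebra_simps power2_eq_square)
  qed
  then have orth2: "p - q + c2 * (t + w ^ 2 * r + w * s) = 0" using orth by simp
  have swap: "q - p + (- d) * X = 0" if "p - q + d * X = 0" for d X :: complex
    using that by (simp add: algebra_simps eq_neg_iff_add_eq_0)
  have s1: "p + q + s + t + r = 0" "q + p + s + t + r = 0" "p + q + t + r + s = 0"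
    "q + p + t + r + s = 0" "q + p + r + s + t = 0"
    using sum by (simp_all add: algebra_simps)
  have n12: "p + q \<noteq> 0"
    by (rule no_opposite_pair_12[OF units w c sum orth])
  have n34: "r + s \<noteq> 0"
    by (rule no_opposite_pair_34[OF units w c sum orth roots(1,3)])
  have n45: "s + t \<noteq> 0"
    by (rule no_opposite_pair_34[OF units(1,2,4,5,3) w nc(1) s1(1) orth1 roots(2,1)])
  have n53: "t + r \<noteq> 0"
    by (rule no_opposite_pair_34[OF units(1,2,5,3,4) w nc(2) s1(3) orth2 roots(3,2)])
  have nz: "p \<noteq> 0" "q \<noteq> 0" "r \<noteq> 0" "s \<noteq> 0" "t \<noteq> 0" using units by auto
  have "p + r = 0 \<or> p + s = 0 \<or> p + t = 0 \<or> q + r = 0 \<or> q + s = 0 \<or> q + t = 0"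
    using opp n12 n34 n45 n53 nz by (auto simp: add.commute)
  moreover have "p + r = 0 \<Longrightarrow> ?thesis"
    using twisted_rowI[OF units w c sum orth] by (simp add: twisted_row_def)
  moreover have "p + s = 0 \<Longrightarrow> ?thesis"
    using twisted_rowI[OF units(1,2,4,5,3) w nc(1) s1(1) orth1] by (simp add: twisted_row_def)
  moreover have "p + t = 0 \<Longrightarrow> ?thesis"
    using twisted_rowI[OF units(1,2,5,3,4) w nc(2) s1(3) orth2] by (simp add: twisted_row_def)
  moreover have "q + r = 0 \<Longrightarrow> ?thesis"
    using twisted_rowI[OF units(2,1,3,4,5) w nc(3) s1(5) swap[OF orth]] by (simp add: twisted_row_def)
  moreover have "q + s = 0 \<Longrightarrow> ?thesis"
    using twisted_rowI[OF units(2,1,4,5,3) w nc(4) s1(2) swap[OF orth1]] by (simp add: twisted_row_def)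
  moreover have "q + t = 0 \<Longrightarrow> ?thesis"
    using twisted_rowI[OF units(2,1,5,3,4) w nc(5) s1(4) swap[OF orth2]] by (simp add: twisted_row_def)
  ultimately show ?thesis by blast
qed

text \<open>The ratios \<open>p / q\<close> and \<open>p' / q'\<close> are square roots of -1. Up to
  a nonzero factor the inner product depends only on them and on the relative cyclic shift of the
  two rows, which leaves three values to exclude.\<close>

lemma twisted_rows_not_orthogonal:
  fixes p q r s t p' q' r' s' t' w :: complex
  assumes t1: "twisted_row w p q r s t" and t2: "twisted_row w p' q' r' s' t'"
    and nq: "norm q = 1" "norm q' = 1" and w: "1 + w + w ^ 2 = 0"
  shows "p * cnj p' + q * cnj q' + r * cnj r' + s * cnj s' + t * cnj t' \<noteq> 0"
proof -
  define W where "W = w ^ 2"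
  note w3 = primitive_cube_root(3)[OF w] and nw = primitive_cube_root(4)[OF w]
  have wW: "w * w = W" "W * W = w" "w * W = 1" "W * w = 1"
    using w3 by (simp_all add: W_def power2_eq_square power3_eq_cube mult.assoc)
  have nW: "norm W = 1" using nw by (simp add: W_def norm_power)
  have cw: "cnj w = W" "cnj W = w"
    using wW nw nW by (simp_all add: cnj_norm_1 inverse_unique)
  have nz: "q \<noteq> 0" "q' \<noteq> 0" using nq by auto
  define e where "e = p / q"
  define e' where "e' = p' / q'"
  define u where "u = q * cnj q'"
  have u0: "u \<noteq> 0" using nz by (simp add: u_def)
  have e2: "e * e = - 1" "e' * e' = - 1"
    using t1 t2 nz by (simp_all add: twisted_row_def e_def e'_def power2_eq_square)
  have p: "p = e * q" "p' = e' * q'" using nz by (simp_all add: e_def e'_def)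
  have "norm e' ^ 2 = norm (e' * e')" by (simp add: norm_mult power2_eq_square)
  then have "norm e' ^ 2 = 1" by (simp add: e2)
  then have "norm e' = 1" by (simp add: power2_eq_1_iff) (metis norm_ge_zero not_one_le_zero neg_0_le_iff_le)
  then have ce: "cnj e' = - e'"
    using e2 by (simp add: cnj_norm_1 inverse_unique)
  have ee: "e' = e \<or> e' = - e"
  proof -
    have "(e' - e) * (e' + e) = 0" using e2 by (simp add: algebra_simps)
    then show ?thesis by (auto simp: eq_neg_iff_add_eq_0)
  qed
  have A: "3 - 2 * (e * e') \<noteq> 0" using ee e2 by auto
  \<comment> \<open>For \<open>e' = e\<close> the value is \<open>2 + v\<close>, for
    \<open>e' = - e\<close> it is \<open>v * (1 - 2 * e)\<close>.\<close>
  have B: "1 - e * e' + v * (1 + e' - e) \<noteq> 0" if v: "norm v = 1" for v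
    using ee
  proof
    assume "e' = e"
    moreover have "2 + v \<noteq> 0"
    proof
      assume "2 + v = 0"
      then have "v = - 2" by (simp add: eq_neg_iff_add_eq_0 add.commute)
      then show False using v by simp
    qed
    ultimately show ?thesis using e2 by simp
  next
    assume e': "e' = - e"
    have "1 - 2 * e \<noteq> 0"
    proof
      assume "1 - 2 * e = 0"
      then have "e = 1 / 2" by (simp add: field_simps)
      then have "e * e = 1 / 2 * (1 / 2)" by (simp only:)
      then show False using e2(1) by simp
    qed
    moreover have "v \<noteq> 0" using v by auto
    moreover have "1 - e * e' + v * (1 + e' - e) = v * (1 - 2 * e)" using e2 e' by (simp add: algebra_simps)
    ultimately show ?thesis by simp
  qed
  have "p * cnj p' + q * cnj q' + r * cnj r' + s * cnj s' + t * cnj t' \<in>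
     {u * (3 - 2 * (e * e')), u * (1 - e * e' + w * (1 + e' - e)), u * (1 - e * e' + W * (1 + e' - e))}"
  proof -
    have 1: "r = - (e * q) \<and> s = W * q \<and> t = w * q \<or>
      s = - (e * q) \<and> t = W * q \<and> r = w * q \<or> t = - (e * q) \<and> r = W * q \<and> s = w * q"
      using t1 by (simp add: twisted_row_def W_def p)
    have 2: "r' = - (e' * q') \<and> s' = W * q' \<and> t' = w * q' \<or>
      s' = - (e' * q') \<and> t' = W * q' \<and> r' = w * q' \<or> t' = - (e' * q') \<and> r' = W * q' \<and> s' = w * q'"
      using t2 by (simp add: twisted_row_def W_def p)
    have wW': "w * (w * x) = W * x" "W * (W * x) = w * x" "w * (W * x) = x" "W * (w * x) = x" for x
      using wW by (simp_all flip: mult.assoc)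
    show ?thesis
      using 1 2 unfolding p u_def
      by (elim disjE conjE; simp only: complex_cnj_mult complex_cnj_minus cw ce insert_iff empty_iff;
          simp add: algebra_simps wW wW')
  qed
  then show ?thesis using u0 A B[OF nw] B[OF nW] by auto
qed

section \<open>Characters and tilings\<close>

lemma character_norm: "character l \<Longrightarrow> norm (l x) = 1"
  by (simp add: character_def)

lemma character_neq_0 [simp]: "character l \<Longrightarrow> l x \<noteq> 0"
  by (metis character_norm norm_zero zero_neq_one)

lemma character_diff:
  assumes "character l"
  shows "l (x - y) = l x / l y"
proof -
  have "l x = l (x - y) * l y"
    using assms unfolding character_def by (metis diff_add_cancel)
  then show ?thesis using assms by simp
qed

lemma character_ratio:
  assumes "character l" "character m"
  shows "character (\<lambda>x. l x * cnj (m x))"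
  using assms by (auto simp: character_def norm_mult)

text \<open>Powers of \<open>l x\<close> are again values of \<open>l\<close>, hence finitely many,
  so two of them coincide.\<close>

lemma character_root_of_unity:
  fixes l :: "'a::{finite,ab_group_add} \<Rightarrow> complex"
  assumes "character l"
  shows "\<exists>n>0. l x ^ n = 1"
proof -
  have pow: "l x ^ n \<in> range l" for n
  proof (induction n)
    case 0
    have "l 0 = l 0 * l 0" using assms unfolding character_def by (metis add_0)
    then have "l 0 = 1" using assms by simp
    then show ?case by (metis power_0 rangeI)
  next
    case (Suc n)
    then obtain y where "l x ^ n = l y" by auto
    then have "l x ^ Suc n = l (x + y)" using assms by (simp add: character_def)
    then show ?case by simp
  qed
  have "finite (range (\<lambda>n. l x ^ n))"
    by (rule finite_subset[of _ "range l"]) (use pow in auto)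
  then have "\<not> inj (\<lambda>n. l x ^ n)" using finite_imageD infinite_UNIV_nat by blast
  then obtain i j where "i < j" "l x ^ i = l x ^ j"
    unfolding inj_def by (metis nat_neq_iff)
  then have "l x ^ i * l x ^ (j - i) = l x ^ i * 1"
    by (metis le_add_diff_inverse less_imp_le mult.right_neutral power_add)
  then have "l x ^ (j - i) = 1" using assms by simp
  then show ?thesis using \<open>i < j\<close> zero_less_diff by blast
qed

lemma tilesI:
  assumes "\<And>x. \<exists>!a. a \<in> A \<and> x - a \<in> T"
  shows "tiles A"
  unfolding tiles_def
proof (intro exI[of _ T] allI)
  fix x
  obtain a where a: "a \<in> A" "x - a \<in> T" and uniq: "\<And>b. b \<in> A \<Longrightarrow> x - b \<in> T \<Longrightarrow> b = a"
    using assms[of x] by blast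
  show "\<exists>!p. fst p \<in> A \<and> snd p \<in> T \<and> x = fst p + snd p"
  proof (rule ex1I[of _ "(a, x - a)"])
    fix p assume p: "fst p \<in> A \<and> snd p \<in> T \<and> x = fst p + snd p"
    then have "snd p = x - fst p" by (simp add: algebra_simps)
    then show "p = (a, x - a)" using p uniq by (metis prod.collapse)
  qed (use a in simp)
qed

text \<open>\<open>l ` A\<close> is a coset of the group of \<open>card A\<close>-th roots of unity, and \<open>c\<close> picks one root from
  each such coset.\<close>

lemma tiles_if_character_values_coset:
  fixes A :: "'a::{finite,ab_group_add} set"
  assumes l: "character l" and inj: "inj_on l A" and n: "card A > 0"
    and k: "\<And>a. a \<in> A \<Longrightarrow> l a ^ card A = k"
  shows "tiles A"
proof -
  let ?n = "card A"
  obtain a0 where a0: "a0 \<in> A" using n by fastforce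
  have k0: "k \<noteq> 0" using k[OF a0] l by auto
  have img: "l ` A = {u. u ^ ?n = k}"
  proof (rule card_subset_eq)
    show "card (l ` A) = card {u. u ^ ?n = k}"
      using card_image[OF inj] card_nth_roots[OF k0 n] by simp
    then show "finite {u. u ^ ?n = k}" using card_image[OF inj] n by (intro card_ge_0_finite) simp
  qed (use k in auto)
  define c where "c w = (SOME v::complex. v ^ ?n = w)" for w
  have c: "c (v ^ ?n) ^ ?n = v ^ ?n" for v unfolding c_def by (rule someI) (rule refl)
  show ?thesis
  proof (rule tilesI)
    fix x
    \<comment> \<open>For all \<open>a\<close> in \<open>A\<close> the powers of
      \<open>l (x - a)\<close> agree with \<open>w\<close>, so \<open>x - b\<close> lies in the
      tiling complement exactly when \<open>l (x - b)\<close> is the chosen root \<open>c w\<close>,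
      and this fixes \<open>l b\<close>.\<close>
    define w where "w = l x ^ ?n / k"
    have w: "l (x - a) ^ ?n = w" if "a \<in> A" for a
      using k[OF that] l by (simp add: w_def character_diff power_divide)
    have cw: "c w ^ ?n = w" using c[of "l (x - a0)"] w[OF a0] by simp
    have w0: "w \<noteq> 0" using k0 l by (simp add: w_def)
    then have c0: "c w \<noteq> 0" using cw n by (metis power_0_left less_numeral_extra(3))
    have "(l x / c w) ^ ?n = l x ^ ?n / w" by (simp only: power_divide cw)
    also have "\<dots> = k" using k0 l by (simp add: w_def)
    finally have "l x / c w \<in> l ` A" unfolding img by (rule CollectI)
    then obtain a where a: "a \<in> A" "l a = l x / c w" by auto
    have iff: "x - b \<in> {t. l t = c (l t ^ ?n)} \<longleftrightarrow> l b = l a" if "b \<in> A" for b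
    proof -
      have "x - b \<in> {t. l t = c (l t ^ ?n)} \<longleftrightarrow> l x / l b = c w"
        using w[OF that] l by (simp add: character_diff)
      also have "\<dots> \<longleftrightarrow> l b = l a"
        using a c0 l by (auto simp: field_simps)
      finally show ?thesis .
    qed
    show "\<exists>!a. a \<in> A \<and> x - a \<in> {t. l t = c (l t ^ ?n)}"
    proof (rule ex1I[of _ a])
      show "a \<in> A \<and> x - a \<in> {t. l t = c (l t ^ ?n)}" using a(1) iff by blast
      show "b = a" if "b \<in> A \<and> x - b \<in> {t. l t = c (l t ^ ?n)}" for b
        using that iff[of b] a(1) inj_onD[OF inj] by blast
    qed
  qed
qed

text \<open>\<open>l\<close> separates \<open>{a, b}\<close> from \<open>{c, d}\<close> by sign and
  \<open>m\<close> separates within each pair, so choosing one from each two opposite values of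
  \<open>l\<close> and of \<open>m\<close> singles out exactly one of the four elements.\<close>

lemma tiles_four:
  fixes a b c d :: "'a::{finite,ab_group_add}"
  assumes l: "character l" and m: "character m"
    and la: "l b = l a" "l c = - l a" "l d = - l a"
    and ma: "m b = - m a" "m d = - m c"
  shows "tiles {a, b, c, d}"
proof -
  \<comment> \<open>The principal root of \<open>u ^ 2\<close> is \<open>u\<close> or
    \<open>- u\<close>, so \<open>half\<close> holds for exactly one of the two when
    \<open>u\<close> is nonzero.\<close>
  define half where "half u \<longleftrightarrow> u = csqrt (u ^ 2)" for u :: complex
  have half: "half (- u) \<longleftrightarrow> \<not> half u" if "u \<noteq> 0" for u
  proof -
    have "csqrt (u ^ 2) = u \<or> csqrt (u ^ 2) = - u"
      using power2_csqrt[of "u ^ 2"] by (simp only: power2_eq_iff)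
    then show ?thesis using that by (auto simp: half_def)
  qed
  show ?thesis
  proof (rule tilesI)
    fix x
    let ?T = "{t. half (l t) \<and> half (m t)}"
    define u v v' where "u = l (x - a)" and "v = m (x - a)" and "v' = m (x - c)"
    have eqs: "l (x - b) = u" "l (x - c) = - u" "l (x - d) = - u" "m (x - b) = - v" "m (x - d) = - v'"
      using la ma l m by (simp_all add: u_def v_def v'_def character_diff)
    have "u \<noteq> 0" "v \<noteq> 0" "v' \<noteq> 0" using l m by (simp_all add: u_def v_def v'_def)
    then have "x - a \<in> ?T \<longleftrightarrow> half u \<and> half v" "x - b \<in> ?T \<longleftrightarrow> half u \<and> \<not> half v"
      "x - c \<in> ?T \<longleftrightarrow> \<not> half u \<and> half v'" "x - d \<in> ?T \<longleftrightarrow> \<not> half u \<and> \<not> half v'"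
      using eqs half by (simp_all add: u_def v_def v'_def)
    then show "\<exists>!y. y \<in> {a, b, c, d} \<and> x - y \<in> ?T"
      by (cases "half u"; cases "half v"; cases "half v'"; simp; metis)
  qed
qed

text \<open>Each row splits \<open>A\<close> into two opposite pairs. If both rows pair
  \<open>a\<close> with the same element, orthogonality makes \<open>x\<close> times the conjugate
  of \<open>y\<close> take opposite values on the two pairs. Otherwise the orthogonality relation
  factors, and one of the rows itself takes just two opposite values.\<close>

lemma tiles_four_rows:
  fixes A :: "'a::{finite,ab_group_add} set"
  assumes A: "card A = 4" and x: "character x" "(\<Sum>a\<in>A. x a) = 0"
    and y: "character y" "(\<Sum>a\<in>A. y a) = 0" and xy: "(\<Sum>a\<in>A. x a * cnj (y a)) = 0"
  shows "tiles A"
proof -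
  obtain a where "a \<in> A" using A by fastforce
  define B where "B = A - {a}"
  have B: "A = insert a B" "a \<notin> B" "card B = 3"
    using A \<open>a \<in> A\<close> by (auto simp: B_def)
  have partner: "\<exists>b c d. B = {b, c, d} \<and> b \<noteq> c \<and> b \<noteq> d \<and> c \<noteq> d \<and> f a + f b = 0 \<and> f c + f d = 0"
    if f: "character f" "(\<Sum>a\<in>A. f a) = 0" for f
  proof -
    obtain b c d where bcd: "B = {b, c, d}" "b \<noteq> c" "b \<noteq> d" "c \<noteq> d"
      using B(3) by (auto simp: card_3_iff)
    have sum: "f a + f b + f c + f d = 0" using f(2) B bcd by (simp add: add.assoc)
    then consider "f a + f b = 0" | "f a + f c = 0" | "f a + f d = 0"
      using four_units_sum_0[of "f a" "f b" "f c" "f d"] f(1) character_norm by blast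
    then show ?thesis
    proof cases
      case 1
      then have "f c + f d = 0" using sum by (simp add: add.assoc)
      then show ?thesis using bcd 1 by blast
    next
      case 2
      moreover have "f a + f c + (f b + f d) = 0" using sum by (simp add: ac_simps)
      ultimately have "f b + f d = 0" by simp
      moreover have "B = {c, b, d}" using bcd by blast
      ultimately show ?thesis using bcd 2 by metis
    next
      case 3
      moreover have "f a + f d + (f b + f c) = 0" using sum by (simp add: ac_simps)
      ultimately have "f b + f c = 0" by simp
      moreover have "B = {d, b, c}" using bcd by blast
      ultimately show ?thesis using bcd 3 by metis
    qed
  qed
  obtain b c d where bcd: "B = {b, c, d}" "b \<noteq> c" "b \<noteq> d" "c \<noteq> d"
    and xb: "x a + x b = 0" "x c + x d = 0"
    using partner[OF x] by blast
  obtain b' c' d' where bcd': "B = {b', c', d'}" "b' \<noteq> c'" "b' \<noteq> d'" "c' \<noteq> d'"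
    and yb': "y a + y b' = 0" "y c' + y d' = 0"
    using partner[OF y] by blast
  have A': "A = {a, b, c, d}" "a \<noteq> b" "a \<noteq> c" "a \<noteq> d" using B bcd by auto
  have nz: "x a \<noteq> 0" "x c \<noteq> 0" "y a \<noteq> 0" "y c \<noteq> 0" using x y by simp_all
  have ux: "x b = - x a" "x d = - x c" using xb by (simp_all add: add_eq_0_iff2 add_eq_0_iff)
  have orth: "x a * cnj (y a) + x b * cnj (y b) + x c * cnj (y c) + x d * cnj (y d) = 0"
    using xy A' bcd by (simp add: add.assoc)
  \<comment> \<open>The case of different partners: \<open>a\<close> is opposite to \<open>b\<close>
    under \<open>x\<close> and to \<open>p\<close> under \<open>y\<close>.\<close>
  have two: "tiles A" if cd: "A = {a, b, p, q}" "x p + x q = 0" "y a + y p = 0" "y b + y q = 0"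
    "x a * cnj (y a) + x b * cnj (y b) + x p * cnj (y p) + x q * cnj (y q) = 0" for p q
  proof -
    have x': "x b = - x a" "x q = - x p" and y': "y p = - y a" "y q = - y b"
      using cd xb by (simp_all add: add_eq_0_iff2 add_eq_0_iff)
    have "(x a - x p) * (cnj (y a) - cnj (y b)) = 0"
      using cd(5) unfolding x' y' by (simp add: algebra_simps)
    then have "x p = x a \<or> y b = y a" by auto
    then show ?thesis
    proof
      assume "x p = x a"
      then have "tiles {a, p, b, q}"
        using x' y' by (intro tiles_four[OF x(1) y(1)]) simp_all
      moreover have "A = {a, p, b, q}" using cd by blast
      ultimately show ?thesis by simp
    next
      assume "y b = y a"
      then show ?thesis unfolding cd(1)
        using x' y' by (intro tiles_four[OF y(1) x(1)]) simp_all
    qed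
  qed
  have rest': "{c', d'} = B - {b'}" using bcd' by auto
  have rest: "B - {b} = {c, d}" "B - {c} = {b, d}" "B - {d} = {b, c}" using bcd by auto
  have "b' \<in> {b, c, d}" using bcd(1) bcd'(1) by blast
  then consider "b' = b" | "b' = c" | "b' = d" by blast
  then show ?thesis
  proof cases
    case 1
    then have "{c', d'} = {c, d}" using rest rest' by simp
    then have "y c + y d = 0" using yb' by (auto simp: doubleton_eq_iff add.commute)
    then have uy: "y b = - y a" "y d = - y c" using yb' 1 by (simp_all add: add_eq_0_iff2 add_eq_0_iff)
    have "2 * (x a * cnj (y a) + x c * cnj (y c)) = 0"
      using orth unfolding ux uy by (simp add: add.commute)
    then have xyc: "x c * cnj (y c) = - (x a * cnj (y a))"
      by (simp add: add_eq_0_iff2 del: distrib_left_numeral)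
    show ?thesis unfolding A'(1)
      using ux uy xyc by (intro tiles_four[OF character_ratio[OF x(1) y(1)] x(1)]) simp_all
  next
    case 2
    then have "{c', d'} = {b, d}" using rest rest' by simp
    then have "y b + y d = 0" using yb' by (auto simp: doubleton_eq_iff add.commute)
    then show ?thesis using two[of c d] A' xb yb' 2 orth by simp
  next
    case 3
    then have "{c', d'} = {b, c}" using rest rest' by simp
    then have "y b + y c = 0" using yb' by (auto simp: doubleton_eq_iff add.commute)
    moreover have "A = {a, b, d, c}" using A' by blast
    moreover have "x d + x c = 0" using xb by (simp add: add.commute)
    moreover have "x a * cnj (y a) + x b * cnj (y b) + x d * cnj (y d) + x c * cnj (y c) = 0"
      using orth by (simp add: ac_simps)
    ultimately show ?thesis using two[of d c] yb' 3 by simp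
  qed
qed

text \<open>Multiplying by the conjugate of a fixed member \<open>m\<close> of norm 1 keeps all
  inner products and turns \<open>m\<close> into the trivial character, orthogonality to which is
  the vanishing of the sum.\<close>

lemma spectral_rows:
  fixes A :: "'a::{finite,ab_group_add} set"
  assumes "spectral A" "A \<noteq> {}"
  obtains R where "finite R" "card R = card A - 1"
    "\<And>x. x \<in> R \<Longrightarrow> character x" "\<And>x. x \<in> R \<Longrightarrow> (\<Sum>a\<in>A. x a) = 0"
    "\<And>x y. x \<in> R \<Longrightarrow> y \<in> R \<Longrightarrow> x \<noteq> y \<Longrightarrow> (\<Sum>a\<in>A. x a * cnj (y a)) = 0"
proof -
  obtain L where L': "\<forall>l\<in>L. character l" "finite L" "card L = card A"
    "\<forall>l\<in>L. \<forall>m\<in>L. l \<noteq> m \<longrightarrow> (\<Sum>a\<in>A. l a * cnj (m a)) = 0"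
    using assms(1) unfolding spectral_def by (elim exE conjE)
  note L = bspec[OF L'(1)] L'(2,3)
  have orth: "(\<Sum>a\<in>A. l a * cnj (m a)) = 0" if "l \<in> L" "m \<in> L" "l \<noteq> m" for l m
    using L'(4) that by simp
  have "card A > 0" using assms(2) by (simp add: card_gt_0_iff)
  then obtain m where m: "m \<in> L" using L by fastforce
  have mm: "m a * cnj (m a) = 1" for a
    using character_norm[OF L(1)[OF m]] by (simp only: complex_norm_square[symmetric]) simp
  define f where "f l = (\<lambda>a. l a * cnj (m a))" for l :: "'a \<Rightarrow> complex"
  have inj: "inj f"
  proof (rule injI)
    fix l l' assume "f l = f l'"
    then have "l a * cnj (m a) = l' a * cnj (m a)" for a unfolding f_def by meson
    moreover have "cnj (m a) \<noteq> 0" for a using mm[of a] by auto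
    ultimately show "l = l'" by auto
  qed
  have prod: "f l a * cnj (f l' a) = l a * cnj (l' a)" for l l' a
  proof -
    have "f l a * cnj (f l' a) = l a * cnj (l' a) * (m a * cnj (m a))" by (simp add: f_def mult_ac)
    then show ?thesis by (simp add: mm)
  qed
  show ?thesis
  proof (rule that[of "f ` (L - {m})"])
    show "card (f ` (L - {m})) = card A - 1"
      using inj m L by (simp add: card_image inj_on_subset[OF inj])
    show "character x" if "x \<in> f ` (L - {m})" for x
      using that L(1) m character_ratio by (auto simp: f_def)
    show "(\<Sum>a\<in>A. x a) = 0" if "x \<in> f ` (L - {m})" for x
      using that orth m by (auto simp: f_def)
    show "(\<Sum>a\<in>A. x a * cnj (y a)) = 0"
      if xy: "x \<in> f ` (L - {m})" "y \<in> f ` (L - {m})" "x \<noteq> y" for x y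
    proof -
      obtain l l' where "x = f l" "y = f l'" "l \<in> L" "l' \<in> L" using xy by blast
      moreover from this have "l \<noteq> l'" using xy(3) by blast
      ultimately show ?thesis using orth by (simp only: prod)
    qed
  qed (use L in simp)
qed

lemma tiles_five_rows:
  fixes A :: "'a::{finite,ab_group_add} set"
  assumes A: "card A = 5" and R: "card R = 4" "\<And>x. x \<in> R \<Longrightarrow> character x"
    and sum: "\<And>x. x \<in> R \<Longrightarrow> (\<Sum>a\<in>A. x a) = 0"
    and orth: "\<And>x y. x \<in> R \<Longrightarrow> y \<in> R \<Longrightarrow> x \<noteq> y \<Longrightarrow> (\<Sum>a\<in>A. x a * cnj (y a)) = 0"
  shows "tiles A"
proof (rule ccontr)
  assume nt: "\<not> tiles A"
  \<comment> \<open>A row without an opposite pair would be a pentagon, whose values form a coset of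
    the fifth roots of unity and give a tiling.\<close>
  have opp: "\<exists>a\<in>A. \<exists>b\<in>A. x a + x b = 0" if x: "x \<in> R" for x
  proof (rule ccontr)
    assume "\<not> ?thesis"
    then have inj: "inj_on x A" and p5: "\<forall>a\<in>A. \<forall>b\<in>A. x a ^ 5 = x b ^ 5"
      using sum_five_roots_of_unity[OF A character_root_of_unity[OF R(2)[OF x]] sum[OF x]] by blast+
    have "A \<noteq> {}" using A by auto
    then obtain a0 where a0: "a0 \<in> A" by blast
    have "x a ^ card A = x a0 ^ 5" if "a \<in> A" for a
      using bspec[OF bspec[OF p5 that] a0] by (simp only: A)
    then have "tiles A"
      using A by (intro tiles_if_character_values_coset[OF R(2)[OF x] inj]) simp
    then show False using nt by contradiction
  qed
  obtain x where xR: "x \<in> R" using R(1) by fastforce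
  define S where "S = R - {x}"
  have S: "R = insert x S" "x \<notin> S" "card S = 3"
    using R(1) xR by (auto simp: S_def)
  have nR: "norm (y a) = 1" if "y \<in> R" for y a using R(2)[OF that] by (rule character_norm)
  obtain a1 a2 where a12: "a1 \<in> A" "a2 \<in> A" "x a1 + x a2 = 0" using opp[OF xR] by blast
  have "a1 \<noteq> a2" using a12(3) R(2)[OF xR] by auto
  then have "card (A - {a1, a2}) = 3" using A a12 by (simp add: card_Diff_subset)
  then obtain a3 a4 a5 where a345: "A - {a1, a2} = {a3, a4, a5}" "a3 \<noteq> a4" "a3 \<noteq> a5" "a4 \<noteq> a5"
    by (auto simp: card_3_iff)
  have ne: "a1 \<noteq> a3" "a1 \<noteq> a4" "a1 \<noteq> a5" "a2 \<noteq> a3" "a2 \<noteq> a4" "a2 \<noteq> a5"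
    using a345(1) by blast+
  have A5: "A = {a1, a2, a3, a4, a5}" using a345(1) a12 by blast
  have sum5: "(\<Sum>a\<in>A. f a) = f a1 + f a2 + f a3 + f a4 + f a5" for f :: "'a \<Rightarrow> complex"
    unfolding A5 using ne a345(2-4) \<open>a1 \<noteq> a2\<close> by (simp add: add.assoc)
  define w where "w = x a4 / x a3"
  have x0: "x a \<noteq> 0" for a using R(2)[OF xR] by simp
  have x345: "x a3 + x a4 + x a5 = 0" using sum[OF xR] a12(3) unfolding sum5 by simp
  have "x a3 ^ 2 + x a3 * x a4 + x a4 ^ 2 = 0"
    by (rule three_units_sum_0(1)[OF nR[OF xR] nR[OF xR] nR[OF xR] x345])
  moreover have x4: "x a4 = w * x a3" using x0 by (simp add: w_def)
  ultimately have "x a3 ^ 2 * (1 + w + w ^ 2) = 0"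
    by (simp add: power2_eq_square algebra_simps)
  then have w: "1 + w + w ^ 2 = 0" using x0 by simp
  note w2 = primitive_cube_root(1)[OF w] and cw = primitive_cube_root(5)[OF w]
  have x5: "x a5 = w ^ 2 * x a3"
    using minus_unique[OF x345] by (simp add: w2 x4 algebra_simps)
  have x2: "x a2 = - x a1" using a12(3) by (simp add: add_eq_0_iff2 add_eq_0_iff)
  \<comment> \<open>Multiplying the orthogonality relation with \<open>x\<close> by
    \<open>x a1\<close> makes the coefficient of \<open>y a1 - y a2\<close> equal to 1 and that of
    the triangle part equal to \<open>c\<close>.\<close>
  define c where "c = x a1 * cnj (x a3)"
  have nc: "norm c = 1" using nR[OF xR] by (simp add: c_def norm_mult)
  have x11: "x a1 * cnj (x a1) = 1"
    using nR[OF xR] by (simp only: complex_norm_square[symmetric]) simp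
  let ?tw = "\<lambda>y. twisted_row w (y a1) (y a2) (y a3) (y a4) (y a5)"
  let ?tw' = "\<lambda>y. twisted_row w (y a2) (y a1) (y a3) (y a4) (y a5)"
  have tw: "?tw y \<or> ?tw' y" if y: "y \<in> S" for y
  proof -
    have yR: "y \<in> R" "y \<noteq> x" using y S by auto
    have "y a1 * cnj (x a1) + y a2 * cnj (x a2) + y a3 * cnj (x a3) + y a4 * cnj (x a4)
      + y a5 * cnj (x a5) = 0"
      using orth[OF yR(1) xR yR(2)] unfolding sum5 .
    moreover have "w ^ 4 = w"
      using primitive_cube_root(3)[OF w] by (simp add: power3_eq_cube power4_eq_xxxx)
    then have "cnj (x a2) = - cnj (x a1)" "cnj (x a4) = w ^ 2 * cnj (x a3)"
      "cnj (x a5) = w * cnj (x a3)"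
      by (simp_all add: x2 x4 x5 cw)
    ultimately have "x a1 * (cnj (x a1) * (y a1 - y a2) + cnj (x a3) * (y a3 + w ^ 2 * y a4 + w * y a5)) = 0"
      by (simp add: algebra_simps)
    then have "(x a1 * cnj (x a1)) * (y a1 - y a2) + c * (y a3 + w ^ 2 * y a4 + w * y a5) = 0"
      by (simp add: c_def algebra_simps)
    then have o: "y a1 - y a2 + c * (y a3 + w ^ 2 * y a4 + w * y a5) = 0" unfolding x11 by simp
    have s: "y a1 + y a2 + y a3 + y a4 + y a5 = 0" using sum[OF yR(1)] unfolding sum5 .
    have "\<exists>p\<in>{y a1, y a2, y a3, y a4, y a5}. \<exists>q\<in>{y a1, y a2, y a3, y a4, y a5}. p + q = 0"
      using opp[OF yR(1)] unfolding A5 by blast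
    then show ?thesis
      by (intro twisted_row_cases[OF _ _ _ _ _ w nc s o])
        (auto intro: nR[OF yR(1)] character_root_of_unity[OF R(2)[OF yR(1)]])
  qed
  have excl: "\<not> (?tw y \<and> ?tw z) \<and> \<not> (?tw' y \<and> ?tw' z)" if yz: "y \<in> S" "z \<in> S" "y \<noteq> z" for y z
  proof -
    have yzR: "y \<in> R" "z \<in> R" using yz S by auto
    have o: "y a1 * cnj (z a1) + y a2 * cnj (z a2) + y a3 * cnj (z a3) + y a4 * cnj (z a4)
      + y a5 * cnj (z a5) = 0"
      using orth[OF yzR yz(3)] unfolding sum5 .
    then have o': "y a2 * cnj (z a2) + y a1 * cnj (z a1) + y a3 * cnj (z a3) + y a4 * cnj (z a4)
      + y a5 * cnj (z a5) = 0" by (simp add: add.commute)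
    show ?thesis
      using twisted_rows_not_orthogonal[OF _ _ nR[OF yzR(1)] nR[OF yzR(2)] w] o o' by blast
  qed
  \<comment> \<open>Pigeonhole: two of these three rows have the same type, against
    \<open>excl\<close>.\<close>
  obtain r s t where "S = {r, s, t}" "r \<noteq> s" "r \<noteq> t" "s \<noteq> t"
    using S(3) by (auto simp: card_3_iff)
  then show False using tw excl by (metis insertI1 insertI2)
qed

section \<open>Case distinction by the number of elements\<close>

theorem theorem2p1:
  fixes A :: "'a::{finite,ab_group_add} set"
  assumes "A \<noteq> {}" and "spectral A" and "card A \<le> 5"
  shows "tiles A"
proof -
  obtain R where R: "finite R" "card R = card A - 1"
    and ch: "\<And>x. x \<in> R \<Longrightarrow> character x" and sum: "\<And>x. x \<in> R \<Longrightarrow> (\<Sum>a\<in>A. x a) = 0"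
    and orth: "\<And>x y. x \<in> R \<Longrightarrow> y \<in> R \<Longrightarrow> x \<noteq> y \<Longrightarrow> (\<Sum>a\<in>A. x a * cnj (y a)) = 0"
    using spectral_rows[OF assms(2,1)] by blast
  have pos: "card A > 0" using assms(1) by (simp add: card_gt_0_iff)
  then consider "card A = 1" | "card A = 2" | "card A = 3" | "card A = 4" | "card A = 5"
    using assms(3) by linarith
  then show ?thesis
  proof cases
    case 1
    then obtain a where a: "A = {a}" by (auto simp: card_1_singleton_iff)
    \<comment> \<open>A singleton has no rows, so the trivial character takes their place.\<close>
    have "character (\<lambda>_::'a. 1)" by (simp add: character_def)
    then show ?thesis
      by (rule tiles_if_character_values_coset[where k = 1]) (simp_all add: a)
  next
    case 2
    then obtain x where x: "x \<in> R" using R by fastforce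
    obtain a b where ab: "A = {a, b}" "a \<noteq> b" using 2 by (auto simp: card_2_iff)
    have s: "x a + x b = 0" using sum[OF x] ab by simp
    note sq = two_units_sum_0[OF character_norm[OF ch[OF x]] s]
    show ?thesis
    proof (rule tiles_if_character_values_coset[OF ch[OF x] _ pos])
      show "inj_on x A" using sq(2) by (auto simp: ab(1))
      show "x c ^ card A = x a ^ 2" if "c \<in> A" for c
        using that sq(1) unfolding 2 by (auto simp: ab(1))
    qed
  next
    case 3
    then obtain x where x: "x \<in> R" using R by fastforce
    obtain a b c where abc: "A = {a, b, c}" "a \<noteq> b" "a \<noteq> c" "b \<noteq> c" using 3 by (auto simp: card_3_iff)
    have s: "x a + x b + x c = 0" "x a + x c + x b = 0" "x b + x c + x a = 0"
      using sum[OF x] abc by (simp_all add: ac_simps)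
    note n = character_norm[OF ch[OF x]]
    note cubes = three_units_sum_0(2,3)[OF n n n s(1)] three_units_sum_0(2,3)[OF n n n s(2)]
      three_units_sum_0(3)[OF n n n s(3)]
    show ?thesis
    proof (rule tiles_if_character_values_coset[OF ch[OF x] _ pos])
      show "inj_on x A" using cubes(2,4,5) by (auto simp: abc(1))
      show "x d ^ card A = x a ^ 3" if "d \<in> A" for d
        using that cubes(1,3) unfolding 3 by (auto simp: abc(1))
    qed
  next
    case 4
    then have "card R = 3" using R by simp
    then obtain x y z where "R = {x, y, z}" "x \<noteq> y" by (auto simp: card_3_iff)
    then show ?thesis
      using tiles_four_rows[OF 4, of x y] ch sum orth by simp
  next
    case 5
    then show ?thesis
      using tiles_five_rows[OF 5, of R] R ch sum orth by simp
  qed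
qed

end
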